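(* Let $\mathcal{L}_1$ and $\mathcal{L}_2$ be two non-constant $L$-functions in the extended Selberg class $\mathcal{S}^{\#}$ satisfying the same functional equation, each with first Dirichlet coefficient $a(1)=1$, and let $\alpha\in\mathbb{C}$. Suppose that $\mathcal{L}_1$ and $\mathcal{L}_2$ share $\{\alpha\}$ counting multiplicities, except possibly for a set $G$ of order one convergence type. Then the following hold: (i) if $d_{\mathcal{L}_i}\neq 0$ for $i=1,2$, then $\mathcal{L}_1=\mathcal{L}_2$; (ii) if $d_{\mathcal{L}_i}=0$ for $i=1,2$ and $\alpha\neq 1$, then $\mathcal{L}_1=\mathcal{L}_2$.
   Context: The extended Selberg class $\mathcal{S}^{\#}$ consists of the not identically vanishing Dirichlet series $\mathcal{L}(s)=\sum_{n=1}^{\infty}a(n)n^{-s}$ such that: (i) the series converges absolutely for $\Re(s)>1$; (ii) (analytic continuation) there is an integer $k\ge 0$ such that $(s-1)^k\mathcal{L}(s)$ extends to an entire function of finite order; (iii) (functional equation) there are an integer $K\ge 0$, reals $Q>0$, $\lambda_j>0$, complex numbers $\nu_j$ with $\Re(\nu_j)\ge 0$ ($1\le j\le K$) and $\omega\in\mathbb{C}$ with $|\omega|=1$ such that $\Lambda(s)=\omega\,\overline{\Lambda(1-\overline{s})}$, where $\Lambda(s)=\mathcal{L}(s)Q^s\prod_{j=1}^{K}\Gamma(\lambda_j s+\nu_j)$. The degree of $\mathcal{L}$ is $d_{\mathcal{L}}=2\sum_{j=1}^{K}\lambda_j$ (so $d_{\mathcal{L}}=0$ iff $K=0$); it depends only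 on $\mathcal{L}$. "$L$-function" means an element of $\mathcal{S}^{\#}$, regarded as a meromorphic function on $\mathbb{C}$ (with at most a pole at $s=1$). Two $L$-functions satisfy the same functional equation if (iii) holds for both with the same data $K,Q,\lambda_j,\nu_j,\omega$. $\mathcal{L}_1$ and $\mathcal{L}_2$ share $\{\alpha\}$ counting multiplicities (CM) except for a set $G$ means: $G$ is a set of zeros of $\mathcal{L}_1-\alpha$ or $\mathcal{L}_2-\alpha$ such that at every point of $\mathbb{C}\setminus G$ the functions $\mathcal{L}_1-\alpha$ and $\mathcal{L}_2-\alpha$ have the same zeros with the same multiplicities. Let $n(r,G)$ denote the number of points of $G\cap\{|s|\le r\}$ counted with multiplicity, a point of $G$ being counted as many times as the larger of its orders as a zero of $\mathcal{L}_1-\alpha$ and of $\mathcal{L}_2-\alpha$. The set $G$ is of order one convergence type if $\int_{r_0}^{\infty}\frac{n(r,G)}{r^{2}}\,dr$ converges for some $r_0>0$. *)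

theory Defs
  imports "HOL-Complex_Analysis.Complex_Analysis" "HOL-Library.Landau_Symbols"
begin

text \<open>
  Coefficient sequences are indexed by \<open>nat\<close>; only \<open>a n\<close> with \<open>n \<ge> 1\<close> matters.
\<close>
definition dirichlet_expansion :: "(nat \<Rightarrow> complex) \<Rightarrow> (complex \<Rightarrow> complex) \<Rightarrow> bool" where
  "dirichlet_expansion a L \<longleftrightarrow>
     (\<forall>s. Re s > 1 \<longrightarrow>
        summable (\<lambda>n. norm (a (Suc n) * of_nat (Suc n) powr (- s))) \<and>
        (\<lambda>n. a (Suc n) * of_nat (Suc n) powr (- s)) sums L s)"

definition entire_of_finite_order :: "(complex \<Rightarrow> complex) \<Rightarrow> bool" where
  "entire_of_finite_order f \<longleftrightarrow>
     f holomorphic_on UNIV \<and>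
     (\<exists>A::real. (\<lambda>s. norm (f s)) \<in> O[at_infinity](\<lambda>s. exp (norm s powr A)))"

definition completed_L ::
  "nat \<Rightarrow> real \<Rightarrow> (nat \<Rightarrow> real) \<Rightarrow> (nat \<Rightarrow> complex) \<Rightarrow> (complex \<Rightarrow> complex) \<Rightarrow> complex \<Rightarrow> complex" where
  "completed_L K Q lam \<nu> L s =
     L s * of_real Q powr s * (\<Prod>j=1..K. Gamma (of_real (lam j) * s + \<nu> j))"

text \<open>
  The functional equation is an identity of meromorphic functions. Since HOL functions are total
  (\<open>Gamma\<close> is \<open>0\<close> at its poles), it is required away from a set without accumulation points.
\<close>
definition functional_equation ::
  "nat \<Rightarrow> real \<Rightarrow> (nat \<Rightarrow> real) \<Rightarrow> (nat \<Rightarrow> complex) \<Rightarrow> complex \<Rightarrow> (complex \<Rightarrow> complex) \<Rightarrow> bool" where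
  "functional_equation K Q lam \<nu> \<omega> L \<longleftrightarrow>
     Q > 0 \<and> (\<forall>j\<in>{1..K}. lam j > 0 \<and> Re (\<nu> j) \<ge> 0) \<and> norm \<omega> = 1 \<and>
     (\<forall>\<^sub>\<approx>s\<in>UNIV. completed_L K Q lam \<nu> L s = \<omega> * cnj (completed_L K Q lam \<nu> L (1 - cnj s)))"

text \<open>
  An element of the class is the meromorphic function on the whole plane. Being nicely
  meromorphic fixes its value at \<open>s = 1\<close> (the limit if it exists, \<open>0\<close> at a pole), so equality
  of HOL functions is equality of meromorphic functions.
\<close>
definition ext_selberg_class :: "(complex \<Rightarrow> complex) set" where
  "ext_selberg_class =
     {L. L nicely_meromorphic_on UNIV \<and>
         (\<exists>s. Re s > 1 \<and> L s \<noteq> 0) \<and>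
         (\<exists>a. dirichlet_expansion a L) \<and>
         (\<exists>(k::nat) f. entire_of_finite_order f \<and> (\<forall>s. s \<noteq> 1 \<longrightarrow> f s = (s - 1) ^ k * L s)) \<and>
         (\<exists>K Q lam \<nu> \<omega>. functional_equation K Q lam \<nu> \<omega> L)}"

definition same_functional_equation ::
  "(complex \<Rightarrow> complex) \<Rightarrow> (complex \<Rightarrow> complex) \<Rightarrow> bool" where
  "same_functional_equation L1 L2 \<longleftrightarrow>
     (\<exists>K Q lam \<nu> \<omega>. functional_equation K Q lam \<nu> \<omega> L1 \<and> functional_equation K Q lam \<nu> \<omega> L2)"

text \<open>
  The functional equation of \<open>L\<close> is not unique, but the value \<open>d\<close> below is the same for all of them.
\<close>
definition selberg_degree :: "(complex \<Rightarrow> complex) \<Rightarrow> real" where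
  "selberg_degree L =
     (SOME d. \<exists>K Q lam \<nu> \<omega>. functional_equation K Q lam \<nu> \<omega> L \<and> d = 2 * (\<Sum>j=1..K. lam j))"

text \<open>
  Multiplicity of \<open>s\<close> as a zero of \<open>L - \<alpha>\<close>, for non-constant meromorphic \<open>L\<close>. It is \<open>0\<close> if \<open>s\<close>
  is not a zero; in particular \<open>zorder\<close> is negative at a pole, whatever value \<open>L\<close> is given there.
\<close>
definition value_mult :: "(complex \<Rightarrow> complex) \<Rightarrow> complex \<Rightarrow> complex \<Rightarrow> nat" where
  "value_mult L \<alpha> s = nat (zorder (\<lambda>w. L w - \<alpha>) s)"

definition share_CM_except ::
  "(complex \<Rightarrow> complex) \<Rightarrow> (complex \<Rightarrow> complex) \<Rightarrow> complex \<Rightarrow> complex set \<Rightarrow> bool" where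
  "share_CM_except L1 L2 \<alpha> G \<longleftrightarrow>
     G \<subseteq> {s. value_mult L1 \<alpha> s > 0 \<or> value_mult L2 \<alpha> s > 0} \<and>
     (\<forall>s. s \<notin> G \<longrightarrow> value_mult L1 \<alpha> s = value_mult L2 \<alpha> s)"

text \<open>The index set is finite when \<open>G\<close> consists of zeros of \<open>L1 - \<alpha>\<close> or \<open>L2 - \<alpha>\<close>, with
  \<open>L1\<close>, \<open>L2\<close> non-constant and meromorphic on the plane.\<close>
definition counting ::
  "(complex \<Rightarrow> complex) \<Rightarrow> (complex \<Rightarrow> complex) \<Rightarrow> complex \<Rightarrow> complex set \<Rightarrow> real \<Rightarrow> nat" where
  "counting L1 L2 \<alpha> G r =
     (\<Sum>s\<in>G \<inter> cball 0 r. max (value_mult L1 \<alpha> s) (value_mult L2 \<alpha> s))"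

definition order_one_convergence_type ::
  "(complex \<Rightarrow> complex) \<Rightarrow> (complex \<Rightarrow> complex) \<Rightarrow> complex \<Rightarrow> complex set \<Rightarrow> bool" where
  "order_one_convergence_type L1 L2 \<alpha> G \<longleftrightarrow>
     (\<exists>r0>0. (\<lambda>r. real (counting L1 L2 \<alpha> G r) / r\<^sup>2) integrable_on {r0..})"

end

theory Submission
  imports Defs "HOL-Real_Asymp.Real_Asymp"
begin

text \<open>
  Let \<open>F = (L1 - \<alpha>) / (L2 - \<alpha>)\<close>. Comparing leading Dirichlet terms, \<open>F(s)\<close> is
  \<open>q * exp (b * s)\<close> up to a relative error decaying exponentially as \<open>Re s\<close> tends to infinity,
  with \<open>b\<close> real and \<open>q \<noteq> 0\<close>. The zeros and poles of \<open>F\<close> lie in \<open>G\<close> and \<open>{1}\<close>, so they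
  are carried by genus zero products \<open>P\<close>, \<open>R\<close> of minimal exponential type, and
  \<open>F * exp (- b * s) = (P / R) * exp h\<close> with \<open>h\<close> a polynomial since everything has finite order.
  By Phragmen--Lindelof, a nonzero entire function of minimal exponential type cannot decay
  exponentially along a ray. If \<open>h\<close> were not constant, \<open>P\<close> or \<open>R\<close> would decay so along a ray in
  the right half plane; once \<open>h\<close> is constant, the combination
  \<open>exp h * P - q * R\<close> decays along the positive axis. Hence \<open>F = q * exp (b * s)\<close> identically.

  If \<open>\<alpha> \<noteq> 1\<close>, both leading terms are \<open>1 - \<alpha>\<close>, so \<open>b = 0\<close> and \<open>q = 1\<close>. If \<open>\<alpha> = 1\<close> and
  the degree is positive, both functions vanish at the trivial zeros coming from the poles of the
  first Gamma factor, whence \<open>q * exp (b * s) = 1\<close> there, which again forces \<open>b = 0\<close> and \<open>q = 1\<close>.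
\<close>

section \<open>Entire functions of minimal exponential type\<close>

text \<open>The integral condition on \<open>G\<close> yields convergence of the sum of multiplicity
  over modulus, which is what genus zero products need. Such products have exponential type zero, so
  any positive exponential rate, however small, wins against them; the rate of the quotient comes
  from the gap between \<open>ln N\<close> and \<open>ln (N + 1)\<close> behind a leading term of
  index \<open>N\<close>. \<open>P\<close> and \<open>R\<close> have zeros in the right half plane,
  so \<open>P / R\<close> itself is never estimated there, only cross-multiplied identities are. A
  possible pole at 1 is removed by one common power of \<open>s - 1\<close>, and 1 joins the
  exceptional set. The other obstacle is the degree: \<open>selberg_degree\<close> is read off some
  functional equation of the function, not necessarily the one that \<open>L1\<close> and
  \<open>L2\<close> share. If the shared equation had no Gamma factor, it would reflect the trivial
  zeros coming from another equation to points far to the right, where the leading Dirichlet term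
  excludes zeros. Hence a nonzero degree puts a Gamma factor into the shared equation as
  well.\<close>

lemma powr_three_halves_quadrant:
  assumes "Re z \<ge> 0" "Im z \<ge> 0"
  defines "w \<equiv> z * cis (-(pi/4))"
  shows "Re w \<ge> 0" and "Re (w powr (3/2)) \<ge> cos (3*pi/8) * norm z powr (3/2)"
proof -
  have c: "cos (pi/4) = sqrt 2 / 2" "sin (pi/4) = sqrt 2 / 2"
    by (simp_all add: cos_45 sin_45)
  have "Re w = (Re z + Im z) * (sqrt 2 / 2)"
    unfolding w_def by (simp add: c algebra_simps)
  also have "\<dots> \<ge> 0" using assms(1,2) by (intro mult_nonneg_nonneg) auto
  finally show "Re w \<ge> 0" .
  show "Re (w powr (3/2)) \<ge> cos (3*pi/8) * norm z powr (3/2)"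
  proof (cases "z = 0")
    case True
    thus ?thesis by (simp add: w_def)
  next
    case False
    define t where "t = Im (Ln z)"
    have t: "0 \<le> t" "t \<le> pi/2"
      using False assms(1,2) Re_Ln_pos_le[of z] Im_Ln_pos_le[of z] unfolding t_def by auto
    have Lw: "Ln w = Ln z - \<i> * of_real (pi/4)"
    proof (rule Ln_unique)
      show "exp (Ln z - \<i> * of_real (pi/4)) = w"
        using False unfolding w_def
        by (simp add: diff_conv_add_uminus exp_add cis_conv_exp del: add_uminus_conv_diff)
      show "- pi < Im (Ln z - \<i> * of_real (pi/4))" "Im (Ln z - \<i> * of_real (pi/4)) \<le> pi"
      proof -
        have "Im (Ln z - \<i> * of_real (pi/4)) = t - pi/4" by (simp add: t_def)
        thus "- pi < Im (Ln z - \<i> * of_real (pi/4))" "Im (Ln z - \<i> * of_real (pi/4)) \<le> pi"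
          using t pi_gt_zero by linarith+
      qed
    qed
    have w0: "w \<noteq> 0" using False by (simp add: w_def)
    have "Re (w powr (3/2)) = exp (3/2 * ln (norm z)) * cos (3/2 * (t - pi/4))"
      using w0 False by (simp add: powr_def Lw Re_exp t_def)
    also have "exp (3/2 * ln (norm z)) = norm z powr (3/2)"
      using False by (simp add: powr_def)
    \<comment> \<open>After the rotation the argument lies within pi/4 of 0, so 3/2 of it stays
      within 3 pi/8, short of pi/2.\<close>
    also have "cos (3/2 * (t - pi/4)) \<ge> cos (3*pi/8)"
    proof -
      have "cos (3/2 * (t - pi/4)) = cos \<bar>3/2 * (t - pi/4)\<bar>" by (rule cos_abs_real[symmetric])
      also have "\<dots> \<ge> cos (3*pi/8)"
        by (rule cos_monotone_0_pi_le) (use t pi_gt_zero in \<open>auto simp: abs_if field_simps\<close>)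
      finally show ?thesis .
    qed
    hence "norm z powr (3/2) * cos (3/2 * (t - pi/4)) \<ge> norm z powr (3/2) * cos (3*pi/8)"
      by (intro mult_left_mono) auto
    finally show ?thesis by (simp add: mult.commute)
  qed
qed

text \<open>A quadrant tolerates growth of any order below 2, and exponential type means order 1.
  The damping exponent 3/2 lies between the two: it outgrows \<open>f\<close>, yet after the
  rotation by - pi/4 the real part of the power is still at least a positive multiple of
  \<open>norm z powr (3/2)\<close> on the whole closed quadrant.\<close>

lemma phragmen_lindelof_quadrant:
  fixes f :: "complex \<Rightarrow> complex"
  assumes hol: "f holomorphic_on UNIV"
    and growth: "\<And>z. norm (f z) \<le> C * exp (D * norm z)"
    and re: "\<And>x. x \<ge> 0 \<Longrightarrow> norm (f (of_real x)) \<le> M"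
    and im: "\<And>y. y \<ge> 0 \<Longrightarrow> norm (f (\<i> * of_real y)) \<le> M"
    and "M > 0" and z: "Re z \<ge> 0" "Im z \<ge> 0"
  shows "norm (f z) \<le> M"
proof (cases "Re z = 0 \<or> Im z = 0")
  case True
  hence "z = of_real (Re z) \<or> z = \<i> * of_real (Im z)" by (auto simp: complex_eq_iff)
  thus ?thesis using re[of "Re z"] im[of "Im z"] z by metis
next
  case False
  with z have zpos: "Re z > 0" "Im z > 0" by auto
  define k where "k = cos (3*pi/8)"
  have k: "k > 0" unfolding k_def by (rule cos_gt_zero_pi) (use pi_gt_zero in auto)
  define p where "p = (\<lambda>z. (z * cis (-(pi/4))) powr (3/2 :: complex))"
  have Rep: "Re (p u) \<ge> k * norm u powr (3/2)" if "Re u \<ge> 0" "Im u \<ge> 0" for u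
    using powr_three_halves_quadrant(2)[OF that] by (simp add: p_def k_def)
  have Rep0: "Re (p u) \<ge> 0" if "Re u \<ge> 0" "Im u \<ge> 0" for u
  proof -
    have "0 \<le> k * norm u powr (3/2)" using k by simp
    thus ?thesis using Rep[OF that] by linarith
  qed
  have bound: "norm (f z) * exp (- e * Re (p z)) \<le> M" if e: "e > 0" for e
  proof -
    \<comment> \<open>Damping of order 3/2 outweighs growth of order 1, so the bound
      \<open>M\<close> holds on every sufficiently large arc.\<close>
    have "((\<lambda>R. \<bar>C\<bar> * exp (\<bar>D\<bar> * R - e * k * R powr (3/2))) \<longlongrightarrow> 0) at_top"
      using e k by real_asymp
    hence "eventually (\<lambda>R. \<bar>C\<bar> * exp (\<bar>D\<bar> * R - e * k * R powr (3/2)) < M) at_top"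
      using \<open>M > 0\<close> by (auto intro: order_tendstoD)
    hence "eventually (\<lambda>R. \<bar>C\<bar> * exp (\<bar>D\<bar> * R - e * k * R powr (3/2)) < M \<and> R > norm z) at_top"
      by (intro eventually_conj eventually_gt_at_top)
    then obtain R where R: "\<bar>C\<bar> * exp (\<bar>D\<bar> * R - e * k * R powr (3/2)) < M" "R > norm z"
      by (auto dest: eventually_happens)
    define S where "S = {u. Re u > 0} \<inter> {u. Im u > 0} \<inter> ball 0 R"
    have S_open: "open S" unfolding S_def by (intro open_Int open_halfspace_Re_gt open_halfspace_Im_gt) auto
    define T where "T = {u. Re u \<ge> 0} \<inter> {u. Im u \<ge> 0} \<inter> cball 0 R"
    have T_closed: "closed T" unfolding T_def
      by (intro closed_Int closed_halfspace_Re_ge closed_halfspace_Im_ge) auto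
    have "S \<subseteq> T" unfolding S_def T_def by auto
    hence cl: "closure S \<subseteq> T" using T_closed by (rule closure_minimal)
    define g where "g = (\<lambda>u. f u * exp (- of_real e * p u))"
    have ng: "norm (g u) = norm (f u) * exp (- e * Re (p u))" for u
      by (simp add: g_def norm_mult)
    have "norm (g z) \<le> M"
    proof (rule maximum_modulus_frontier[of g S])
      have "z * cis (-(pi/4)) \<notin> \<real>\<^sub>\<le>\<^sub>0" if "z \<in> S" for z
      proof -
        have "Re z + Im z > 0" using that by (auto simp: S_def)
        hence "Re (z * cis (-(pi/4))) > 0"
          using that by (auto simp: S_def cos_45 sin_45 intro!: add_pos_pos mult_pos_pos)
        thus ?thesis by (auto simp: complex_nonpos_Reals_iff)
      qed
      hence "g holomorphic_on S"
        unfolding g_def p_def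
        by (intro holomorphic_intros holomorphic_on_subset[OF hol]) auto
      thus "g holomorphic_on interior S" using S_open by (simp add: interior_open)
      \<comment> \<open>The rotated quadrant meets the branch cut only at 0, where the power is
        still continuous because its exponent is positive.\<close>
      have "continuous_on T p"
        unfolding p_def
        by (intro continuous_intros)
           (use powr_three_halves_quadrant(1) in \<open>auto simp: T_def\<close>)
      hence "continuous_on T g" unfolding g_def
        using holomorphic_on_imp_continuous_on[OF hol]
        by (intro continuous_intros) (auto intro: continuous_on_subset)
      thus "continuous_on (closure S) g" using cl by (rule continuous_on_subset)
      show "bounded S" unfolding S_def by (auto intro: bounded_Int)
      show "z \<in> S" using zpos R by (auto simp: S_def)
    next
      fix u assume "u \<in> frontier S"
      hence u: "u \<in> T" "u \<notin> S" using cl S_open by (auto simp: frontier_def interior_open)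
      hence u2: "Re u \<ge> 0" "Im u \<ge> 0" by (auto simp: T_def)
      from u consider "Re u = 0" | "Im u = 0" | "norm u = R" by (force simp: S_def T_def)
      thus "norm (g u) \<le> M"
      proof cases
        case 1
        hence "u = \<i> * of_real (Im u)" by (simp add: complex_eq_iff)
        hence "norm (f u) \<le> M" using im[OF u2(2)] by metis
        moreover have "exp (- e * Re (p u)) \<le> 1" using Rep0[OF u2] e by simp
        ultimately show ?thesis unfolding ng using \<open>M > 0\<close> mult_mono[of "norm (f u)" M "exp (- e * Re (p u))" 1] by simp
      next
        case 2
        hence "u = of_real (Re u)" by (simp add: complex_eq_iff)
        hence "norm (f u) \<le> M" using re[OF u2(1)] by metis
        moreover have "exp (- e * Re (p u)) \<le> 1" using Rep0[OF u2] e by simp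
        ultimately show ?thesis unfolding ng using \<open>M > 0\<close> mult_mono[of "norm (f u)" M "exp (- e * Re (p u))" 1] by simp
      next
        case 3
        have R0: "R \<ge> 0" using R(2) norm_ge_zero[of z] by linarith
        have "norm (f u) \<le> C * exp (D * R)" using growth[of u] 3 by simp
        also have "\<dots> \<le> \<bar>C\<bar> * exp (\<bar>D\<bar> * R)"
          using R0 by (intro mult_mono) (auto intro!: mult_right_mono)
        finally have 1: "norm (f u) \<le> \<bar>C\<bar> * exp (\<bar>D\<bar> * R)" .
        have "- e * Re (p u) \<le> - e * k * R powr (3/2)" using Rep[OF u2] e 3
          by (simp add: mult.assoc)
        hence "norm (g u) \<le> \<bar>C\<bar> * exp (\<bar>D\<bar> * R) * exp (- e * k * R powr (3/2))"
          unfolding ng using 1 by (intro mult_mono) auto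
        also have "\<dots> = \<bar>C\<bar> * exp (\<bar>D\<bar> * R - e * k * R powr (3/2))"
          by (simp add: exp_add[symmetric])
        finally show ?thesis using R(1) by linarith
      qed
    qed
    thus ?thesis by (simp add: ng)
  qed
  \<comment> \<open>The bound is uniform in \<open>e\<close>, so the damping can be removed by
    letting \<open>e\<close> tend to 0.\<close>
  have "((\<lambda>e. norm (f z) * exp (- e * Re (p z))) \<longlongrightarrow> norm (f z) * exp (- 0 * Re (p z))) (at_right 0)"
    by (intro tendsto_intros)
  moreover have "eventually (\<lambda>e. norm (f z) * exp (- e * Re (p z)) \<le> M) (at_right 0)"
    using bound by (auto simp: eventually_at_filter)
  ultimately have "norm (f z) * exp (- 0 * Re (p z)) \<le> M"
    by (intro tendsto_upperbound[of _ _ "at_right 0"]) auto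
  thus ?thesis by simp
qed

section \<open>Minimal exponential type and decay along rays\<close>

definition min_exp_type :: "(complex \<Rightarrow> complex) \<Rightarrow> bool" where
  "min_exp_type f \<longleftrightarrow> (\<forall>\<epsilon>>0. \<exists>C. \<forall>z. norm (f z) \<le> C * exp (\<epsilon> * norm z))"

definition exp_decay :: "(complex \<Rightarrow> complex) \<Rightarrow> complex \<Rightarrow> bool" where
  "exp_decay f u \<longleftrightarrow> (\<exists>C c. c > 0 \<and> (\<forall>t\<ge>0. norm (f (of_real t * u)) \<le> C * exp (- c * t)))"

lemma min_exp_typeE:
  assumes "min_exp_type f" "\<epsilon> > 0"
  obtains C where "C > 0" "\<And>z. norm (f z) \<le> C * exp (\<epsilon> * norm z)"
proof -
  obtain C where C: "norm (f z) \<le> C * exp (\<epsilon> * norm z)" for z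
    using assms unfolding min_exp_type_def by blast
  have "norm (f z) \<le> max C 1 * exp (\<epsilon> * norm z)" for z
    by (rule order_trans[OF C mult_right_mono]) auto
  thus ?thesis by (intro that[of "max C 1"]) auto
qed

lemma exp_decayE:
  assumes "exp_decay f u"
  obtains C c where "C > 0" "c > 0" "\<And>t. t \<ge> 0 \<Longrightarrow> norm (f (of_real t * u)) \<le> C * exp (- c * t)"
proof -
  obtain C c where C: "c > 0" "\<And>t. t \<ge> 0 \<Longrightarrow> norm (f (of_real t * u)) \<le> C * exp (- c * t)"
    using assms unfolding exp_decay_def by blast
  have "norm (f (of_real t * u)) \<le> max C 1 * exp (- c * t)" if "t \<ge> 0" for t
    by (rule order_trans[OF C(2)[OF that] mult_right_mono]) auto
  thus ?thesis using C(1) by (intro that[of "max C 1" c]) auto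
qed

lemma min_exp_type_mult:
  assumes "min_exp_type f" "min_exp_type g"
  shows "min_exp_type (\<lambda>z. f z * g z)"
  unfolding min_exp_type_def
proof safe
  fix \<epsilon> :: real assume "\<epsilon> > 0"
  then obtain C D where C: "C > 0" "\<And>z. norm (f z) \<le> C * exp (\<epsilon>/2 * norm z)"
    and D: "D > 0" "\<And>z. norm (g z) \<le> D * exp (\<epsilon>/2 * norm z)"
    using min_exp_typeE[OF assms(1), of "\<epsilon>/2"] min_exp_typeE[OF assms(2), of "\<epsilon>/2"]
    by (metis half_gt_zero)
  have "norm (f z * g z) \<le> C * D * exp (\<epsilon> * norm z)" for z
  proof -
    have "norm (f z * g z) \<le> (C * exp (\<epsilon>/2 * norm z)) * (D * exp (\<epsilon>/2 * norm z))"
      unfolding norm_mult using C D by (intro mult_mono) (auto intro: less_imp_le)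
    also have "\<dots> = C * D * exp (\<epsilon>/2 * norm z + \<epsilon>/2 * norm z)" by (simp only: exp_add mult_ac)
    finally show ?thesis by (simp add: field_simps)
  qed
  thus "\<exists>C. \<forall>z. norm (f z * g z) \<le> C * exp (\<epsilon> * norm z)" by blast
qed

lemma min_exp_type_diff:
  assumes "min_exp_type f" "min_exp_type g"
  shows "min_exp_type (\<lambda>z. f z - g z)"
  unfolding min_exp_type_def
proof safe
  fix \<epsilon> :: real assume "\<epsilon> > 0"
  then obtain C D where C: "C > 0" "\<And>z. norm (f z) \<le> C * exp (\<epsilon> * norm z)"
    and D: "D > 0" "\<And>z. norm (g z) \<le> D * exp (\<epsilon> * norm z)"
    using min_exp_typeE[OF assms(1)] min_exp_typeE[OF assms(2)] by metis
  have "norm (f z - g z) \<le> (C + D) * exp (\<epsilon> * norm z)" for z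
    using norm_triangle_ineq4[of "f z" "g z"] C(2)[of z] D(2)[of z] by (simp add: distrib_right)
  thus "\<exists>C. \<forall>z. norm (f z - g z) \<le> C * exp (\<epsilon> * norm z)" by blast
qed

lemma min_exp_type_linear: "min_exp_type (\<lambda>z. a + b * z)"
  unfolding min_exp_type_def
proof safe
  fix \<epsilon> :: real assume \<epsilon>: "\<epsilon> > 0"
  have "norm (a + b * z) \<le> (norm a + norm b / \<epsilon>) * exp (\<epsilon> * norm z)" for z
  proof -
    have "norm (a + b * z) \<le> norm a + norm b * norm z"
      using norm_triangle_ineq[of a "b * z"] by (simp add: norm_mult)
    also have "\<dots> = norm a * 1 + norm b / \<epsilon> * (\<epsilon> * norm z)" using \<epsilon> by simp
    also have "\<dots> \<le> norm a * exp (\<epsilon> * norm z) + norm b / \<epsilon> * exp (\<epsilon> * norm z)"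
    proof (intro add_mono mult_left_mono)
      show "\<epsilon> * norm z \<le> exp (\<epsilon> * norm z)" using exp_ge_add_one_self[of "\<epsilon> * norm z"] by linarith
    qed (use \<epsilon> in auto)
    finally show ?thesis by (simp add: algebra_simps)
  qed
  thus "\<exists>C. \<forall>z. norm (a + b * z) \<le> C * exp (\<epsilon> * norm z)" by blast
qed

lemma min_exp_type_const: "min_exp_type (\<lambda>_. c)"
  using min_exp_type_linear[of c 0] by simp

lemma min_exp_type_prod:
  "finite A \<Longrightarrow> (\<And>x. x \<in> A \<Longrightarrow> min_exp_type (f x)) \<Longrightarrow> min_exp_type (\<lambda>z. \<Prod>x\<in>A. f x z)"
  by (induction A rule: finite_induct) (auto intro: min_exp_type_const min_exp_type_mult)

text \<open>The factor \<open>exp ((c + \<i> * \<epsilon>) * z)\<close> uses up the decay on the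
  positive real axis and absorbs the type on the positive imaginary axis, so both sides of the
  quadrant are bounded. Despite the name only a quadrant is treated; reflection supplies the other
  half.\<close>

lemma min_exp_type_half_plane:
  fixes P :: "complex \<Rightarrow> complex"
  assumes hol: "P holomorphic_on UNIV" and type: "min_exp_type P"
    and C: "c > 0" "C > 0" "\<And>t. t \<ge> 0 \<Longrightarrow> norm (P (of_real t)) \<le> C * exp (- c * t)"
    and \<epsilon>: "\<epsilon> > 0"
  obtains M where "\<And>z. Re z \<ge> 0 \<Longrightarrow> Im z \<ge> 0 \<Longrightarrow> norm (P z) \<le> M * exp (- c * Re z + \<epsilon> * Im z)"
proof -
  obtain K where K: "K > 0" "\<And>z. norm (P z) \<le> K * exp (\<epsilon> * norm z)"
    using min_exp_typeE[OF type \<epsilon>] by blast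
  define M where "M = max C K"
  have M: "M > 0" "C \<le> M" "K \<le> M" using C K by (auto simp: M_def)
  define f where "f = (\<lambda>z. P z * exp ((of_real c + \<i> * of_real \<epsilon>) * z))"
  have nf: "norm (f z) = norm (P z) * exp (c * Re z - \<epsilon> * Im z)" for z
    by (simp add: f_def norm_mult algebra_simps)
  have "norm (f z) \<le> M" if z: "Re z \<ge> 0" "Im z \<ge> 0" for z
  proof (rule phragmen_lindelof_quadrant[of f K "\<epsilon> + c + \<epsilon>"])
    show "f holomorphic_on UNIV" unfolding f_def by (intro holomorphic_intros hol)
  next
    fix z
    have "c * Re z - \<epsilon> * Im z \<le> c * norm z + \<epsilon> * norm z"
    proof -
      have "c * Re z \<le> c * norm z" using C(1) complex_Re_le_cmod[of z] by simp
      moreover have "\<epsilon> * (- Im z) \<le> \<epsilon> * norm z"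
        using \<epsilon> abs_Im_le_cmod[of z] by (intro mult_left_mono) auto
      ultimately show ?thesis by simp
    qed
    hence "norm (f z) \<le> (K * exp (\<epsilon> * norm z)) * exp (c * norm z + \<epsilon> * norm z)"
      unfolding nf using K by (intro mult_mono) (auto intro: less_imp_le)
    also have "\<dots> = K * exp ((\<epsilon> + c + \<epsilon>) * norm z)" by (simp add: exp_add[symmetric] algebra_simps)
    finally show "norm (f z) \<le> K * exp ((\<epsilon> + c + \<epsilon>) * norm z)" .
  next
    fix x :: real assume "x \<ge> 0"
    hence "norm (f (of_real x)) \<le> (C * exp (- c * x)) * exp (c * x)"
      unfolding nf using C(3)[of x] by simp
    also have "\<dots> = C" by (simp add: mult.assoc exp_add[symmetric])
    finally show "norm (f (of_real x)) \<le> M" using M by linarith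
  next
    fix y :: real assume "y \<ge> 0"
    hence "norm (f (\<i> * of_real y)) \<le> (K * exp (\<epsilon> * y)) * exp (- \<epsilon> * y)"
      unfolding nf using K(2)[of "\<i> * of_real y"] by (simp add: norm_mult)
    also have "\<dots> = K" by (simp add: mult.assoc exp_add[symmetric])
    finally show "norm (f (\<i> * of_real y)) \<le> M" using M by linarith
  qed (use M z in auto)
  hence "norm (P z) \<le> M * exp (- c * Re z + \<epsilon> * Im z)" if "Re z \<ge> 0" "Im z \<ge> 0" for z
    using that unfolding nf by (simp add: exp_diff exp_add exp_minus field_simps)
  thus ?thesis by (rule that)
qed

text \<open>Rotation moves the ray to the positive axis. The lower quadrant is the upper one for the
  conjugate reflection \<open>P2\<close>, which has the same type and the same decay.\<close>

lemma exp_decay_half_plane: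
  assumes hol: "P holomorphic_on UNIV" and type: "min_exp_type P"
    and C: "c > 0" "C > 0" "\<And>t. t \<ge> 0 \<Longrightarrow> norm (P (of_real t * u)) \<le> C * exp (- c * t)"
    and \<epsilon>: "\<epsilon> > 0" "norm u = 1"
  obtains M where "\<And>z. Re z \<ge> 0 \<Longrightarrow> norm (P (z * u)) \<le> M * exp (- c * Re z + \<epsilon> * \<bar>Im z\<bar>)"
proof -
  define P1 where "P1 = (\<lambda>z. P (z * u))"
  define P2 where "P2 = (\<lambda>z. cnj (P1 (cnj z)))"
  have hol1: "P1 holomorphic_on UNIV"
  proof -
    have "(\<lambda>z. z * u) holomorphic_on UNIV" by (intro holomorphic_intros)
    from holomorphic_on_compose_gen[OF this hol] show ?thesis by (simp add: P1_def o_def)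
  qed
  have "P2 = cnj \<circ> P1 \<circ> cnj" by (auto simp: P2_def)
  moreover have "cnj ` UNIV = UNIV" by (metis complex_cnj_cnj surjI)
  ultimately have hol2: "P2 holomorphic_on UNIV"
    using hol1 holomorphic_on_compose_cnj_cnj[of P1 UNIV] by simp
  have type1: "min_exp_type P1"
    using type \<epsilon>(2) unfolding P1_def min_exp_type_def by (metis norm_mult mult.right_neutral)
  hence type2: "min_exp_type P2"
    unfolding P2_def min_exp_type_def by (metis complex_mod_cnj)
  obtain M1 where
      M1: "\<And>z. Re z \<ge> 0 \<Longrightarrow> Im z \<ge> 0 \<Longrightarrow> norm (P1 z) \<le> M1 * exp (- c * Re z + \<epsilon> * Im z)"
    using min_exp_type_half_plane[OF hol1 type1 C(1,2) _ \<epsilon>(1)] C(3) unfolding P1_def by metis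
  obtain M2 where
      M2: "\<And>z. Re z \<ge> 0 \<Longrightarrow> Im z \<ge> 0 \<Longrightarrow> norm (P2 z) \<le> M2 * exp (- c * Re z + \<epsilon> * Im z)"
    using min_exp_type_half_plane[OF hol2 type2 C(1,2) _ \<epsilon>(1)] C(3)
    unfolding P1_def P2_def by (metis complex_cnj_complex_of_real complex_mod_cnj)
  have "norm (P (z * u)) \<le> max M1 M2 * exp (- c * Re z + \<epsilon> * \<bar>Im z\<bar>)" if "Re z \<ge> 0" for z
  proof (cases "Im z \<ge> 0")
    case True
    hence "norm (P (z * u)) \<le> M1 * exp (- c * Re z + \<epsilon> * \<bar>Im z\<bar>)" using M1[OF that] by (simp add: P1_def)
    also have "\<dots> \<le> max M1 M2 * exp (- c * Re z + \<epsilon> * \<bar>Im z\<bar>)" by (intro mult_right_mono) auto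
    finally show ?thesis .
  next
    case False
    hence "norm (P (z * u)) \<le> M2 * exp (- c * Re z + \<epsilon> * \<bar>Im z\<bar>)"
      using M2[of "cnj z"] that by (simp add: P1_def P2_def)
    also have "\<dots> \<le> max M1 M2 * exp (- c * Re z + \<epsilon> * \<bar>Im z\<bar>)" by (intro mult_right_mono) auto
    finally show ?thesis .
  qed
  thus ?thesis using that by blast
qed

text \<open>The loss \<open>\<epsilon>\<close> in the half-plane bound is arbitrary, hence can be
  made small against the decay; so every ray at an angle below pi/2 inherits exponential
  decay.\<close>

lemma exp_decay_rotate:
  assumes hol: "P holomorphic_on UNIV" and type: "min_exp_type P" and dec: "exp_decay P u"
    and u: "norm u = 1" and v: "Re v > 0"
  shows "exp_decay P (v * u)"
proof -
  obtain C c where C: "C > 0" "c > 0" "\<And>t. t \<ge> 0 \<Longrightarrow> norm (P (of_real t * u)) \<le> C * exp (- c * t)"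
    using exp_decayE[OF dec] by metis
  \<comment> \<open>Chosen to give \<open>\<epsilon> * \<bar>Im v\<bar> \<le> c * Re v / 2\<close>,
    so that half of the decay survives; the summand 1 covers real \<open>v\<close>.\<close>
  define \<epsilon> where "\<epsilon> = c * Re v / (2 * (\<bar>Im v\<bar> + 1))"
  have \<epsilon>: "\<epsilon> > 0" using C v by (auto simp: \<epsilon>_def)
  obtain M where M: "\<And>z. Re z \<ge> 0 \<Longrightarrow> norm (P (z * u)) \<le> M * exp (- c * Re z + \<epsilon> * \<bar>Im z\<bar>)"
    using exp_decay_half_plane[OF hol type C(2,1) C(3) \<epsilon> u] by metis
  have M0: "M \<ge> 0"
    using order_trans[OF norm_ge_zero M[of 0]] by simp
  have "\<epsilon> * \<bar>Im v\<bar> \<le> \<epsilon> * (\<bar>Im v\<bar> + 1)" using \<epsilon> by (intro mult_left_mono) auto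
  also have "\<dots> = c * Re v / 2"
  proof -
    have "x / (2 * d) * d = x / 2" if "d \<noteq> 0" for x d :: real using that by simp
    from this[of "\<bar>Im v\<bar> + 1" "c * Re v"] show ?thesis unfolding \<epsilon>_def by linarith
  qed
  finally have le: "\<epsilon> * \<bar>Im v\<bar> \<le> c * Re v / 2" .
  have "norm (P (of_real t * (v * u))) \<le> M * exp (- (c * Re v / 2) * t)" if t: "t \<ge> 0" for t
  proof -
    have "norm (P ((of_real t * v) * u)) \<le> M * exp (- c * (t * Re v) + \<epsilon> * \<bar>t * Im v\<bar>)"
      using M[of "of_real t * v"] t v by simp
    also have "- c * (t * Re v) + \<epsilon> * \<bar>t * Im v\<bar> \<le> - (c * Re v / 2) * t"
      using mult_right_mono[OF le t] t by (simp add: abs_mult algebra_simps)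
    hence "M * exp (- c * (t * Re v) + \<epsilon> * \<bar>t * Im v\<bar>) \<le> M * exp (- (c * Re v / 2) * t)"
      using M0 by (intro mult_left_mono) auto
    finally show ?thesis by (simp add: mult.assoc)
  qed
  thus ?thesis unfolding exp_decay_def using C v
    by (intro exI[of _ M] exI[of _ "c * Re v / 2"]) auto
qed

text \<open>With \<open>\<epsilon> = c\<close> the exponent is nonpositive in the sector of
  half-angle pi/4; four rotated copies of this sector cover the plane.\<close>

lemma exp_decay_sector_bounded:
  assumes hol: "P holomorphic_on UNIV" and type: "min_exp_type P" and dec: "exp_decay P u"
    and u: "norm u = 1"
  obtains M where "\<And>z. \<bar>Im z\<bar> \<le> Re z \<Longrightarrow> norm (P (z * u)) \<le> M"
proof -
  obtain C c where C: "C > 0" "c > 0" "\<And>t. t \<ge> 0 \<Longrightarrow> norm (P (of_real t * u)) \<le> C * exp (- c * t)"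
    using exp_decayE[OF dec] by metis
  obtain M where M: "\<And>z. Re z \<ge> 0 \<Longrightarrow> norm (P (z * u)) \<le> M * exp (- c * Re z + c * \<bar>Im z\<bar>)"
    using exp_decay_half_plane[OF hol type C(2,1) C(3) C(2) u] by metis
  have M0: "M \<ge> 0"
    using order_trans[OF norm_ge_zero M[of 0]] by simp
  have "norm (P (z * u)) \<le> M" if "\<bar>Im z\<bar> \<le> Re z" for z
  proof -
    have "norm (P (z * u)) \<le> M * exp (- c * Re z + c * \<bar>Im z\<bar>)" using M that by auto
    also have "\<dots> \<le> M * 1" using M0 that C(2) by (intro mult_left_mono) auto
    finally show ?thesis by simp
  qed
  thus ?thesis by (rule that)
qed

text \<open>Decay along one ray spreads to four rays spaced by quarter turns. The function is then
  bounded in four sectors covering the plane, hence constant by Liouville, and the decay makes the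
  constant 0.\<close>

theorem min_exp_type_decay_eq_0:
  assumes hol: "P holomorphic_on UNIV" and type: "min_exp_type P" and dec: "exp_decay P u"
    and u: "norm u = 1"
  shows "P z = 0"
proof -
  \<comment> \<open>\<open>exp_decay_rotate\<close> needs an angle strictly below pi/2, so each
    quarter turn is composed of two eighth turns.\<close>
  define e :: complex where "e = cis (pi/4)"
  have e: "norm e = 1" "Re e > 0" by (auto simp: e_def cos_45)
  have ee: "e * e = \<i>" unfolding e_def by (simp add: cis_mult)
  have step: "exp_decay P (\<i> * v)" if "exp_decay P v" "norm v = 1" for v
  proof -
    have "exp_decay P (e * v)" using exp_decay_rotate[OF hol type that] e by simp
    hence "exp_decay P (e * (e * v))" using exp_decay_rotate[OF hol type, of "e * v" e] e that
      by (simp add: norm_mult)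
    thus ?thesis using ee by (simp add: mult.assoc[symmetric])
  qed
  have d: "exp_decay P u" "exp_decay P (\<i> * u)" "exp_decay P (- u)" "exp_decay P (- (\<i> * u))"
    using dec step[of u] step[of "\<i> * u"] step[of "-u"] u by (auto simp: norm_mult mult.assoc[symmetric])
  obtain M1 where M1: "\<And>z. \<bar>Im z\<bar> \<le> Re z \<Longrightarrow> norm (P (z * u)) \<le> M1"
    using exp_decay_sector_bounded[OF hol type d(1)] u by metis
  obtain M2 where M2: "\<And>z. \<bar>Im z\<bar> \<le> Re z \<Longrightarrow> norm (P (z * (\<i> * u))) \<le> M2"
    using exp_decay_sector_bounded[OF hol type d(2)] u by (metis mult_1 norm_ii norm_mult)
  obtain M3 where M3: "\<And>z. \<bar>Im z\<bar> \<le> Re z \<Longrightarrow> norm (P (z * (- u))) \<le> M3"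
    using exp_decay_sector_bounded[OF hol type d(3)] u by (metis norm_minus_cancel)
  obtain M4 where M4: "\<And>z. \<bar>Im z\<bar> \<le> Re z \<Longrightarrow> norm (P (z * (- (\<i> * u)))) \<le> M4"
    using exp_decay_sector_bounded[OF hol type d(4)] u by (metis mult_1 norm_ii norm_mult norm_minus_cancel)
  define M where "M = Max {M1, M2, M3, M4}"
  have MM: "M1 \<le> M" "M2 \<le> M" "M3 \<le> M" "M4 \<le> M" by (auto simp: M_def)
  have u0: "u \<noteq> 0" using u by auto
  have "norm (P w) \<le> M" for w
  proof -
    define z where "z = w / u"
    have w: "w = z * u" using u0 by (simp add: z_def)
    consider "\<bar>Im z\<bar> \<le> Re z" | "\<bar>Im z\<bar> \<le> - Re z" | "\<bar>Re z\<bar> \<le> Im z" | "\<bar>Re z\<bar> \<le> - Im z" by linarith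
    thus ?thesis
    proof cases
      case 1 thus ?thesis using M1[of z] MM w by simp
    next
      case 2 thus ?thesis using M3[of "-z"] MM w by simp
    next
      case 3
      have "w = (- \<i> * z) * (\<i> * u)" by (simp add: w complex_eq_iff)
      thus ?thesis using M2[of "- \<i> * z"] MM 3 by simp
    next
      case 4
      have "w = (\<i> * z) * (- (\<i> * u))" by (simp add: w complex_eq_iff)
      thus ?thesis using M4[of "\<i> * z"] MM 4 by simp
    qed
  qed
  hence "bounded (range P)" by (auto simp: bounded_iff)
  then obtain k where k: "\<And>z. P z = k"
    using Liouville_theorem[OF hol] by (auto simp: constant_on_def)
  obtain C c where C: "C > 0" "c > 0" "\<And>t. t \<ge> 0 \<Longrightarrow> norm (P (of_real t * u)) \<le> C * exp (- c * t)"
    using exp_decayE[OF dec] by metis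
  have "((\<lambda>t. C * exp (- c * t)) \<longlongrightarrow> 0) at_top" using C(2) by real_asymp
  moreover have "eventually (\<lambda>t. norm k \<le> C * exp (- c * t)) at_top"
    using eventually_ge_at_top[of 0] by eventually_elim (use C(3) k in auto)
  ultimately have "norm k \<le> 0" by (intro tendsto_lowerbound) auto
  thus ?thesis using k by simp
qed

section \<open>Zero-free quotients of entire functions of finite order\<close>

lemma exp_decayI_eventually:
  assumes "continuous_on UNIV f" "c > 0"
    and ev: "eventually (\<lambda>t. norm (f (of_real t * u)) \<le> C * exp (- c * t)) at_top"
  shows "exp_decay f u"
proof -
  obtain T where T: "\<And>t. t \<ge> T \<Longrightarrow> norm (f (of_real t * u)) \<le> C * exp (- c * t)"
    using ev by (auto simp: eventually_at_top_linorder)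
  have cont: "continuous_on {0..T} (\<lambda>t. f (of_real t * u))"
    using continuous_on_compose2[OF assms(1), of "{0..T}" "\<lambda>t. of_real t * u"]
    by (simp add: continuous_intros)
  have "compact ((\<lambda>t. norm (f (of_real t * u)) * exp (c * t)) ` {0..T})"
    by (intro compact_continuous_image continuous_on_mult continuous_on_norm continuous_on_exp
        continuous_on_const continuous_on_id compact_Icc cont)
  hence "bounded ((\<lambda>t. norm (f (of_real t * u)) * exp (c * t)) ` {0..T})" by (rule compact_imp_bounded)
  hence "\<exists>K. \<forall>t\<in>{0..T}. norm (norm (f (of_real t * u)) * exp (c * t)) \<le> K"
    unfolding bounded_iff by simp
  then obtain K where K: "\<And>t. t \<in> {0..T} \<Longrightarrow> norm (norm (f (of_real t * u)) * exp (c * t)) \<le> K"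
    by metis
  have "norm (f (of_real t * u)) \<le> max C K * exp (- c * t)" if t: "t \<ge> 0" for t
  proof (cases "t \<le> T")
    case True
    hence "norm (f (of_real t * u)) \<le> K * exp (- c * t)"
      using K[of t] t by (simp add: exp_minus field_simps)
    also have "\<dots> \<le> max C K * exp (- c * t)" by (intro mult_right_mono) auto
    finally show ?thesis .
  next
    case False
    hence "norm (f (of_real t * u)) \<le> C * exp (- c * t)" using T by auto
    also have "\<dots> \<le> max C K * exp (- c * t)" by (intro mult_right_mono) auto
    finally show ?thesis .
  qed
  thus ?thesis using assms(2) unfolding exp_decay_def
    by (intro exI[of _ "max C K"] exI[of _ c]) simp
qed

text \<open>The map \<open>f / (2 * M - f)\<close> takes the half plane \<open>Re < M\<close> into
  the unit disc and fixes 0. The Schwarz lemma bounds it by 1/2 at half the radius, and solving for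
  \<open>f\<close> gives the constant \<open>2 * M\<close>.\<close>

lemma borel_caratheodory_half:
  assumes hol: "f holomorphic_on ball 0 R" and f0: "f 0 = 0"
    and less: "\<And>z. norm z < R \<Longrightarrow> Re (f z) < M"
    and z: "norm z \<le> R / 2" and R: "R > 0"
  shows "norm (f z) \<le> 2 * M"
proof -
  have M: "M > 0" using less[of 0] R f0 by simp
  have lt: "norm (f w) < norm (2 * of_real M - f w)" if "norm w < R" for w
  proof -
    have "(Re (f w))\<^sup>2 + (Im (f w))\<^sup>2 < (2 * M - Re (f w))\<^sup>2 + (Im (f w))\<^sup>2"
      using mult_strict_left_mono[OF less[OF that] M] by (simp add: power2_eq_square algebra_simps)
    hence "(norm (f w))\<^sup>2 < (norm (2 * of_real M - f w))\<^sup>2"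
      unfolding cmod_power2 by simp
    thus ?thesis by (rule power2_less_imp_less) auto
  qed
  have nz: "2 * of_real M - f w \<noteq> 0" if "norm w < R" for w using lt[OF that] by auto
  define g where "g = (\<lambda>w. f (of_real R * w) / (2 * of_real M - f (of_real R * w)))"
  have in_ball: "norm (of_real R * w) < R" if "norm w < 1" for w :: complex
    using that R by (simp add: norm_mult)
  have "(\<lambda>w. f (of_real R * w)) holomorphic_on ball 0 1"
  proof -
    have "(\<lambda>w. of_real R * w) holomorphic_on ball 0 1" by (intro holomorphic_intros)
    moreover have "(\<lambda>w. of_real R * w) ` ball 0 1 \<subseteq> ball (0::complex) R"
      using in_ball by (simp add: image_subset_iff)
    ultimately show ?thesis
      using holomorphic_on_compose_gen[OF _ hol] unfolding o_def by blast
  qed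
  hence "g holomorphic_on ball 0 1"
    unfolding g_def using nz in_ball by (intro holomorphic_intros) auto
  moreover have "g 0 = 0" by (simp add: g_def f0)
  moreover have "norm (g w) < 1" if "norm w < 1" for w
    using lt[OF in_ball[OF that]] nz[OF in_ball[OF that]] by (simp add: g_def norm_divide)
  moreover define w where "w = z / of_real R"
  have w: "norm w \<le> 1/2" using z R by (simp add: w_def norm_divide field_simps)
  ultimately have "norm (g w) \<le> norm w" by (intro Schwarz_Lemma(1)) auto
  hence gw: "norm (g w) \<le> 1/2" using w by linarith
  have zR: "norm z < R" using z R by linarith
  have "g w = f z / (2 * of_real M - f z)" using R by (simp add: g_def w_def)
  hence "norm (f z) = norm (g w) * norm (2 * of_real M - f z)"
    using nz[OF zR] by (simp add: norm_divide)
  also have "\<dots> \<le> 1/2 * (2 * M + norm (f z))"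
    using gw norm_triangle_ineq4[of "2 * of_real M" "f z"] M by (intro mult_mono) (auto simp: norm_mult)
  finally show ?thesis by simp
qed

lemma entire_divide_zero:
  assumes "f holomorphic_on UNIV" "f a = 0"
  obtains g where "g holomorphic_on UNIV" "\<And>z. f z = (z - a) * g z"
proof
  show "(\<lambda>z. if z = a then deriv f a else (f z - f a) / (z - a)) holomorphic_on UNIV"
    using assms(1) by (intro pole_lemma) auto
  show "f z = (z - a) * (if z = a then deriv f a else (f z - f a) / (z - a))" for z
    using assms(2) by simp
qed

lemma norm_le_on_cball:
  assumes "f holomorphic_on UNIV" "R > 0" "\<And>z. norm z = R \<Longrightarrow> norm (f z) \<le> B" "norm z \<le> R"
  shows "norm (f z) \<le> B"
proof (rule maximum_modulus_frontier[of f "cball 0 R"])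
  show "continuous_on (closure (cball 0 R)) f"
    using holomorphic_on_imp_continuous_on[OF assms(1)] by (rule continuous_on_subset) auto
  show "f holomorphic_on interior (cball 0 R)" using assms(1) by (rule holomorphic_on_subset) auto
qed (use assms in auto)

text \<open>The number of zeros split off is bounded because each factor has modulus at least 2 on the
  circle of radius \<open>3 * R\<close> and value 1 at 0.\<close>
lemma split_zeros_in_cball:
  assumes hol: "g holomorphic_on UNIV" and g0: "g 0 \<noteq> 0" and R: "R > 0"
    and B: "\<And>z. norm z = 3 * R \<Longrightarrow> norm (g z) \<le> B"
  obtains p g1 where "p holomorphic_on UNIV" "g1 holomorphic_on UNIV" "\<And>z. g z = p z * g1 z"
    "p 0 = 1" "\<And>z. norm z \<le> R \<Longrightarrow> g1 z \<noteq> 0" "\<And>z. norm z = 3 * R \<Longrightarrow> norm (p z) \<ge> 1"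
proof -
  define Q where "Q = (\<lambda>n p g1. p holomorphic_on UNIV \<and> g1 holomorphic_on UNIV \<and>
    (\<forall>z. g z = p z * g1 z) \<and> p 0 = 1 \<and> (\<forall>z. norm z = 3 * R \<longrightarrow> norm (p z) \<ge> 2 ^ n))"
  have Q0: "Q 0 (\<lambda>_. 1) g" using hol by (auto simp: Q_def)
  have bound: "norm (g 0) * 2 ^ n \<le> B" if Qn: "Q n p g1" for n p g1
  proof -
    have hol1: "g1 holomorphic_on UNIV" and g1_0: "g1 0 = g 0" using Qn by (simp_all add: Q_def)
    have "norm (g1 z) \<le> B / 2 ^ n" if z: "norm z = 3 * R" for z
    proof -
      have p: "norm (p z) \<ge> 2 ^ n" using Qn z by (auto simp: Q_def)
      have "2 ^ n * norm (g1 z) \<le> norm (p z) * norm (g1 z)" using p by (intro mult_right_mono) auto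
      also have "\<dots> = norm (g z)" using Qn by (simp add: Q_def norm_mult)
      also have "\<dots> \<le> B" using B z by blast
      finally show ?thesis by (subst pos_le_divide_eq) (simp_all add: mult.commute)
    qed
    hence "norm (g1 0) \<le> B / 2 ^ n"
      by (rule norm_le_on_cball[OF hol1, of "3 * R", rotated]) (use R in simp_all)
    thus ?thesis unfolding g1_0 by (subst (asm) pos_le_divide_eq) simp_all
  qed
  \<comment> \<open>Zeros are not counted: \<open>g 0 \<noteq> 0\<close> bounds
    \<open>2 ^ n\<close>, so there is a last \<open>n\<close> that can be reached, and a zero left
    in the disc would allow one more factor.\<close>
  have "\<exists>n. (\<exists>p g1. Q n p g1) \<and> \<not> (\<exists>p g1. Q (Suc n) p g1)"
  proof (rule ccontr)
    assume *: "\<not> ?thesis"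
    have "\<exists>p g1. Q n p g1" for n
    proof (induction n)
      case 0
      show ?case using Q0 by blast
    qed (use * in blast)
    hence *: "norm (g 0) * 2 ^ n \<le> B" for n using bound by blast
    have "filterlim (\<lambda>n::nat. norm (g 0) * 2 ^ n) at_top at_top"
      using g0 by real_asymp
    hence "eventually (\<lambda>n::nat. norm (g 0) * 2 ^ n > B) at_top" by (simp add: filterlim_at_top_dense)
    then obtain n :: nat where "norm (g 0) * 2 ^ n > B" by (auto dest: eventually_happens)
    thus False using *[of n] by linarith
  qed
  then obtain n p g1 where n: "Q n p g1" "\<And>p g1. \<not> Q (Suc n) p g1" by blast
  have "g1 a \<noteq> 0" if a: "norm a \<le> R" for a
  proof
    assume "g1 a = 0"
    then obtain g2 where g2: "g2 holomorphic_on UNIV" "\<And>z. g1 z = (z - a) * g2 z"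
      using entire_divide_zero[of g1 a] n(1) by (auto simp: Q_def)
    have a0: "a \<noteq> 0"
    proof
      assume "a = 0"
      hence "g 0 = 0" using n(1) \<open>g1 a = 0\<close> unfolding Q_def by simp
      thus False using g0 by simp
    qed
    have "Q (Suc n) (\<lambda>z. p z * (1 - z / a)) (\<lambda>z. - a * g2 z)"
      unfolding Q_def
    proof (intro conjI allI impI)
      show "(\<lambda>z. p z * (1 - z / a)) holomorphic_on UNIV" "(\<lambda>z. - a * g2 z) holomorphic_on UNIV"
        using n(1) g2 a0 by (auto simp: Q_def intro!: holomorphic_intros)
    next
      fix z
      show "g z = p z * (1 - z / a) * (- a * g2 z)"
      proof -
        have "g z = p z * g1 z" using n(1) by (simp add: Q_def)
        also have "g1 z = (1 - z / a) * (- a * g2 z)"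
          using a0 by (simp add: g2(2)[of z] diff_divide_distrib left_diff_distrib)
        finally show ?thesis by (simp add: mult.assoc)
      qed
    next
      show "p 0 * (1 - 0 / a) = 1" using n(1) by (simp add: Q_def)
    next
      fix z :: complex assume z: "norm z = 3 * R"
      have "2 * norm a \<le> norm (a - z)" using norm_triangle_ineq2[of z a] z a by (simp add: norm_minus_commute)
      hence "2 \<le> norm (a - z) / norm a" using a0 by (simp add: field_simps)
      also have "\<dots> = norm (1 - z / a)" using a0 by (simp add: norm_divide[symmetric] diff_divide_distrib)
      finally have "2 ^ n * 2 \<le> norm (p z) * norm (1 - z / a)"
        using n(1) z by (intro mult_mono) (auto simp: Q_def)
      thus "2 ^ Suc n \<le> norm (p z * (1 - z / a))" by (simp add: norm_mult mult.commute)
    qed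
    thus False using n(2) by blast
  qed
  moreover have "norm (p z) \<ge> 1" if "norm z = 3 * R" for z
  proof -
    have "2 ^ n \<le> norm (p z)" using n(1) that by (simp add: Q_def)
    moreover have "(1::real) \<le> 2 ^ n" by simp
    ultimately show ?thesis by linarith
  qed
  moreover have "p holomorphic_on UNIV" "g1 holomorphic_on UNIV" "\<And>z. g z = p z * g1 z" "p 0 = 1"
    using n(1) by (simp_all add: Q_def)
  ultimately show ?thesis by (intro that)
qed

text \<open>In contrast to the asymptotic bound of \<open>entire_of_finite_order\<close>, this one
  holds at every point. The base \<open>1 + norm z\<close> is at least 1, so exponents can be raised
  to a common value when functions are combined.\<close>

definition fin_order :: "(complex \<Rightarrow> complex) \<Rightarrow> bool" where
  "fin_order f \<longleftrightarrow> (\<exists>B n. \<forall>z. norm (f z) \<le> exp (B * (1 + norm z) ^ n))"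

lemma fin_orderE:
  assumes "fin_order f"
  obtains B n where "B > 0" "\<And>z m. m \<ge> n \<Longrightarrow> norm (f z) \<le> exp (B * (1 + norm z) ^ m)"
proof -
  obtain B n where B: "\<And>z. norm (f z) \<le> exp (B * (1 + norm z) ^ n)"
    using assms unfolding fin_order_def by blast
  have "norm (f z) \<le> exp ((\<bar>B\<bar> + 1) * (1 + norm z) ^ m)" if "m \<ge> n" for z m
  proof -
    have "B * (1 + norm z) ^ n \<le> (\<bar>B\<bar> + 1) * (1 + norm z) ^ m"
      using that by (intro mult_mono power_increasing) auto
    thus ?thesis using B[of z] by (meson exp_le_cancel_iff order_trans)
  qed
  thus ?thesis by (intro that[of "\<bar>B\<bar> + 1" n]) auto
qed

lemma fin_order_mult:
  assumes "fin_order f" "fin_order g"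
  shows "fin_order (\<lambda>z. f z * g z)"
proof -
  obtain B n where B: "\<And>z m. m \<ge> n \<Longrightarrow> norm (f z) \<le> exp (B * (1 + norm z) ^ m)"
    using fin_orderE[OF assms(1)] by metis
  obtain C k where C: "\<And>z m. m \<ge> k \<Longrightarrow> norm (g z) \<le> exp (C * (1 + norm z) ^ m)"
    using fin_orderE[OF assms(2)] by metis
  have "norm (f z * g z) \<le> exp ((B + C) * (1 + norm z) ^ max n k)" for z
  proof -
    have "norm (f z * g z) \<le> exp (B * (1 + norm z) ^ max n k) * exp (C * (1 + norm z) ^ max n k)"
      unfolding norm_mult using B C by (intro mult_mono) auto
    thus ?thesis by (simp add: exp_add[symmetric] distrib_right)
  qed
  thus ?thesis unfolding fin_order_def by blast
qed

lemma fin_order_diff: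
  assumes "fin_order f" "fin_order g"
  shows "fin_order (\<lambda>z. f z - g z)"
proof -
  obtain B n where B: "B > 0" "\<And>z m. m \<ge> n \<Longrightarrow> norm (f z) \<le> exp (B * (1 + norm z) ^ m)"
    using fin_orderE[OF assms(1)] by metis
  obtain C k where C: "C > 0" "\<And>z m. m \<ge> k \<Longrightarrow> norm (g z) \<le> exp (C * (1 + norm z) ^ m)"
    using fin_orderE[OF assms(2)] by metis
  have "norm (f z - g z) \<le> exp ((B + C + 1) * (1 + norm z) ^ max n k)" for z
  proof -
    define x where "x = (1 + norm z) ^ max n k"
    have x: "x \<ge> 1" unfolding x_def by (intro one_le_power) auto
    have "norm (f z - g z) \<le> exp (B * x) + exp (C * x)"
      using norm_triangle_ineq4[of "f z" "g z"] B(2)[of "max n k" z] C(2)[of "max n k" z]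
      by (simp add: x_def)
    also have "\<dots> \<le> 2 * exp ((B + C) * x)"
    proof -
      have "exp (B * x) \<le> exp ((B + C) * x)" "exp (C * x) \<le> exp ((B + C) * x)"
        using x B(1) C(1) by (simp_all add: distrib_right)
      thus ?thesis by linarith
    qed
    also have "2 \<le> exp x" using exp_ge_add_one_self[of x] x by linarith
    hence "2 * exp ((B + C) * x) \<le> exp x * exp ((B + C) * x)" by (intro mult_right_mono) auto
    also have "\<dots> = exp ((B + C + 1) * x)" by (simp add: exp_add[symmetric] algebra_simps)
    finally show ?thesis by (simp add: x_def)
  qed
  thus ?thesis unfolding fin_order_def by blast
qed

lemma fin_order_of_min_exp_type:
  assumes "min_exp_type f"
  shows "fin_order f"
proof -
  obtain C where C: "C > 0" "\<And>z. norm (f z) \<le> C * exp (1 * norm z)"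
    using min_exp_typeE[OF assms, of 1] by auto
  have "norm (f z) \<le> exp ((\<bar>ln C\<bar> + 1) * (1 + norm z) ^ 1)" for z
  proof -
    have "norm (f z) \<le> exp (ln C + norm z)" using C by (simp add: exp_add)
    also have "ln C + norm z \<le> (\<bar>ln C\<bar> + 1) * (1 + norm z) ^ 1"
    proof -
      have "0 \<le> \<bar>ln C\<bar> * norm z" by simp
      thus ?thesis unfolding power_one_right distrib_right distrib_left by linarith
    qed
    finally show ?thesis by simp
  qed
  thus ?thesis unfolding fin_order_def by blast
qed

lemma fin_order_exp_linear: "fin_order (\<lambda>z. exp (a + b * z))"
proof -
  have "norm (exp (a + b * z)) \<le> exp ((norm a + norm b) * (1 + norm z) ^ 1)" for z
  proof -
    have "Re (a + b * z) \<le> norm a + norm b * norm z"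
      using complex_Re_le_cmod[of "a + b * z"] norm_triangle_ineq[of a "b * z"] by (simp add: norm_mult)
    also have "\<dots> \<le> (norm a + norm b) * (1 + norm z) ^ 1" by (simp add: algebra_simps)
    finally show ?thesis by simp
  qed
  thus ?thesis unfolding fin_order_def by blast
qed

lemma fin_order_linear: "fin_order (\<lambda>z. a + b * z)"
  by (intro fin_order_of_min_exp_type min_exp_type_linear)

lemma fin_order_const: "fin_order (\<lambda>z. c)"
  using fin_order_linear[of c 0] by simp

lemma fin_order_power: "fin_order f \<Longrightarrow> fin_order (\<lambda>z. f z ^ n)"
  by (induction n) (auto intro: fin_order_const fin_order_mult)

text \<open>Dividing numerator and denominator by a common polynomial that removes the zeros in a disc
  makes the lower bound for the denominator accessible to Borel--Caratheodory.\<close>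
lemma exponent_growth:
  assumes hol: "f holomorphic_on UNIV" "g holomorphic_on UNIV" "h holomorphic_on UNIV"
    and eq: "\<And>z. f z = g z * exp (h z)" and g0: "g 0 \<noteq> 0"
    and fin: "fin_order f" "fin_order g"
  obtains A n where "A > 0" "\<And>z. Re (h z) < A * (1 + norm z) ^ n"
proof -
  obtain B1 n1 where B1: "B1 > 0" "\<And>z m. m \<ge> n1 \<Longrightarrow> norm (f z) \<le> exp (B1 * (1 + norm z) ^ m)"
    by (rule fin_orderE[OF fin(1)]) (rule that)
  obtain B2 n2 where B2: "B2 > 0" "\<And>z m. m \<ge> n2 \<Longrightarrow> norm (g z) \<le> exp (B2 * (1 + norm z) ^ m)"
    by (rule fin_orderE[OF fin(2)]) (rule that)
  define B n where "B = max B1 B2" and "n = max n1 n2"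
  have B: "B > 0" using B1 by (auto simp: B_def)
  have fB: "norm (f z) \<le> exp (B * (1 + norm z) ^ n)" for z
    using B1(2)[of n z] by (rule order_trans) (auto simp: B_def n_def intro!: mult_right_mono)
  have gB: "norm (g z) \<le> exp (B * (1 + norm z) ^ n)" for z
    using B2(2)[of n z] by (rule order_trans) (auto simp: B_def n_def intro!: mult_right_mono)
  define L where "L = \<bar>ln (norm (g 0))\<bar>"
  have main: "Re (h z) < 3 * (B * (7 * (1 + norm z)) ^ n + L + 1) + 1" for z
  proof -
    \<comment> \<open>This places \<open>z\<close> in the concentric half of the disc that is
      cleared of zeros, and on the outer circle
      \<open>1 + 3 * R \<le> 7 * (1 + norm z)\<close>.\<close>
    define R where "R = 2 * (1 + norm z)"
    have R: "R > 0" unfolding R_def by (smt (verit) norm_ge_zero)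
    define V where "V = B * (1 + 3 * R) ^ n"
    define M where "M = V + L + 1"
    have gV: "norm (g w) \<le> exp V" if "norm w = 3 * R" for w using gB[of w] that by (simp add: V_def)
    have fV: "norm (f w) \<le> exp V" if "norm w = 3 * R" for w using fB[of w] that by (simp add: V_def)
    obtain p g1 where p: "p holomorphic_on UNIV" "g1 holomorphic_on UNIV" "\<And>z. g z = p z * g1 z"
      "p 0 = 1" "\<And>z. norm z \<le> R \<Longrightarrow> g1 z \<noteq> 0" "\<And>z. norm z = 3 * R \<Longrightarrow> norm (p z) \<ge> 1"
      by (rule split_zeros_in_cball[OF hol(2) g0 R gV]) (assumption, rule that)
    have g1V: "norm (g1 w) \<le> exp V" if "norm w \<le> 3 * R" for w
    proof (rule norm_le_on_cball[OF p(2) _ _ that])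
      fix w :: complex assume w: "norm w = 3 * R"
      have "1 * norm (g1 w) \<le> norm (p w) * norm (g1 w)" using p(6)[OF w] by (intro mult_right_mono) auto
      also have "\<dots> \<le> exp V" using gV[OF w] p(3) by (simp add: norm_mult)
      finally show "norm (g1 w) \<le> exp V" by simp
    qed (use R in auto)
    have f1V: "norm (g1 w * exp (h w)) \<le> exp V" if "norm w \<le> 3 * R" for w
    proof (rule norm_le_on_cball[OF _ _ _ that])
      fix w :: complex assume w: "norm w = 3 * R"
      have "1 * norm (g1 w * exp (h w)) \<le> norm (p w) * norm (g1 w * exp (h w))"
        using p(6)[OF w] by (intro mult_right_mono) auto
      also have "\<dots> = norm (f w)" by (simp add: eq p(3) norm_mult)
      also have "\<dots> \<le> exp V" using fV[OF w] .
      finally show "norm (g1 w * exp (h w)) \<le> exp V" by simp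
    qed (use R p hol in \<open>auto intro!: holomorphic_intros\<close>)
    \<comment> \<open>Being zero-free on the disc, \<open>g1\<close> has a logarithm there. Its real
      part is at most \<open>V\<close>, and Borel-Caratheodory converts this upper bound into the
      lower bound for \<open>norm (g1 z)\<close> that is wanted.\<close>
    obtain k where k: "k holomorphic_on ball 0 R" "\<And>w. w \<in> ball 0 R \<Longrightarrow> g1 w = exp (k w)"
      using contractible_imp_holomorphic_log[of g1 "ball 0 R"] p(2,5)
      by (metis convex_ball convex_imp_contractible holomorphic_on_subset mem_ball_0 less_imp_le subset_UNIV)
    have Rek: "Re (k w) \<le> V" if "norm w < R" for w
    proof -
      have "g1 w = exp (k w)" by (rule k(2)) (use that in simp)
      moreover have "norm (g1 w) \<le> exp V" by (rule g1V) (use that R in linarith)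
      ultimately show ?thesis by simp
    qed
    have "g1 0 = g 0" by (simp add: p(3,4))
    moreover have "g1 0 = exp (k 0)" by (rule k(2)) (use R in simp)
    ultimately have "exp (Re (k 0)) = norm (g 0)" by (metis norm_exp_eq_Re)
    hence k0: "Re (k 0) = ln (norm (g 0))" by (metis ln_exp)
    have zR: "norm z < R" "norm z \<le> R / 2" unfolding R_def using norm_ge_zero[of z] by argo+
    have "norm (k z - k 0) \<le> 2 * M"
    proof (rule borel_caratheodory_half[of "\<lambda>w. k w - k 0" R M z])
      show "Re (k w - k 0) < M" if "norm w < R" for w
        using Rek[OF that] k0 unfolding M_def L_def by simp
    qed (use k R zR in \<open>auto intro!: holomorphic_intros\<close>)
    hence "- Re (k z - k 0) \<le> 2 * M" using abs_Re_le_cmod[of "k z - k 0"] by linarith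
    moreover have "Re (k z) + Re (h z) \<le> V"
    proof -
      have "g1 z = exp (k z)" by (rule k(2)) (use zR in simp)
      moreover have "norm (g1 z * exp (h z)) \<le> exp V" by (rule f1V) (use zR R in linarith)
      ultimately show ?thesis by (simp add: norm_mult exp_add[symmetric])
    qed
    \<comment> \<open>Combines \<open>Re (h z) \<le> V - Re (k z)\<close> with
      \<open>- Re (k z) \<le> 2 * M + L\<close> and \<open>V + L \<le> M\<close>.\<close>
    ultimately have "Re (h z) \<le> 3 * M" using k0 by (simp add: M_def L_def)
    also have "V \<le> B * (7 * (1 + norm z)) ^ n"
      unfolding V_def R_def using B by (intro mult_left_mono power_mono) auto
    hence "3 * M < 3 * (B * (7 * (1 + norm z)) ^ n + L + 1) + 1" by (simp add: M_def)
    finally show ?thesis .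
  qed
  show ?thesis
  proof (rule that[of "3 * B * 7 ^ n + 3 * L + 4" n])
    show "3 * B * 7 ^ n + 3 * L + 4 > 0" using B by (simp add: L_def add_pos_nonneg add_nonneg_pos)
    fix z :: complex
    have "1 \<le> (1 + norm z) ^ n" by (intro one_le_power) auto
    from mult_left_mono[OF this, of "3 * L + 4"] have "3 * L + 4 \<le> (3 * L + 4) * (1 + norm z) ^ n"
      by (simp add: L_def)
    thus "Re (h z) < (3 * B * 7 ^ n + 3 * L + 4) * (1 + norm z) ^ n"
      using main[of z] unfolding power_mult_distrib
      by (simp only: distrib_left distrib_right mult_ac)
  qed
qed

text \<open>Borel-Caratheodory turns the one-sided bound into polynomial growth of the modulus, to
  which the polynomial form of Liouville's theorem applies.\<close>

lemma entire_Re_growth_imp_poly: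
  assumes hol: "h holomorphic_on UNIV" and A: "\<And>z. Re (h z) < A * (1 + norm z) ^ n"
  obtains p where "\<And>z. h z = poly p z"
proof -
  define D where "D = \<bar>A\<bar> + \<bar>Re (h 0)\<bar> + norm (h 0) + 1"
  define h0 where "h0 = (\<lambda>z. h z - h 0)"
  have growth: "norm (h0 z) \<le> 2 * D * 6 ^ n * norm z ^ n" if z: "norm z \<ge> 1" for z
  proof -
    define R where "R = 2 * norm z"
    have R: "R > 0" using z unfolding R_def by linarith
    have "norm (h0 z) \<le> 2 * (D * (1 + R) ^ n)"
    proof (rule borel_caratheodory_half[of h0 R _ z])
      show "h0 holomorphic_on ball 0 R" unfolding h0_def
        by (intro holomorphic_intros holomorphic_on_subset[OF hol]) auto
    next
      fix w :: complex assume w: "norm w < R"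
      have one: "1 \<le> (1 + R) ^ n" using R by (intro one_le_power) auto
      have "A * (1 + norm w) ^ n \<le> \<bar>A\<bar> * (1 + R) ^ n"
        using w by (intro mult_mono power_mono) auto
      moreover have "- Re (h 0) \<le> \<bar>Re (h 0)\<bar> * (1 + R) ^ n"
        using mult_left_mono[OF one, of "\<bar>Re (h 0)\<bar>"] by linarith
      moreover have "0 \<le> (norm (h 0) + 1) * (1 + R) ^ n" using one by simp
      moreover have "D * (1 + R) ^ n = \<bar>A\<bar> * (1 + R) ^ n + \<bar>Re (h 0)\<bar> * (1 + R) ^ n + (norm (h 0) + 1) * (1 + R) ^ n"
        by (simp add: D_def algebra_simps)
      ultimately show "Re (h0 w) < D * (1 + R) ^ n"
        using A[of w] by (simp add: h0_def)
    next
      show "h0 0 = 0" by (simp add: h0_def)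
      show "norm z \<le> R / 2" by (simp add: R_def)
    qed (use R in auto)
    also have "(1 + R) ^ n \<le> (6 * norm z) ^ n" using z by (intro power_mono) (auto simp: R_def)
    hence "2 * (D * (1 + R) ^ n) \<le> 2 * (D * (6 * norm z) ^ n)"
      by (intro mult_left_mono) (auto simp: D_def)
    finally show ?thesis by (simp add: power_mult_distrib mult_ac)
  qed
  have "h0 holomorphic_on UNIV" unfolding h0_def by (intro holomorphic_intros hol)
  from Liouville_polynomial[OF this growth]
  have h0: "h0 z = (\<Sum>k\<le>n. (deriv ^^ k) h0 0 / fact k * z ^ k)" for z by simp
  define p where "p = [:h 0:] + (\<Sum>k\<le>n. monom ((deriv ^^ k) h0 0 / fact k) k)"
  have "h z = poly p z" for z
  proof -
    have "h z = h 0 + h0 z" by (simp add: h0_def)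
    thus ?thesis unfolding h0[of z] p_def by (simp add: poly_sum poly_monom)
  qed
  thus ?thesis by (rule that)
qed

text \<open>The ray has to lie in the open right half plane, since the quotient to which this is
  applied is controlled only there. A slight turn gives the leading term a nonzero real part without
  leaving that half plane.\<close>

lemma poly_Re_on_ray:
  fixes p :: "complex poly"
  assumes "degree p > 0"
  obtains u \<kappa> where "norm u = 1" "Re u > 0" "\<kappa> > 0"
    "eventually (\<lambda>t. Re (poly p (of_real t * u)) \<ge> \<kappa> * t) at_top \<or>
     eventually (\<lambda>t. Re (poly p (of_real t * u)) \<le> - \<kappa> * t) at_top"
proof -
  define N where "N = degree p"
  define c where "c = lead_coeff p"
  have N: "N > 0" and c: "c \<noteq> 0" using assms by (auto simp: N_def c_def)
  obtain u where u: "norm u = 1" "Re u > 0" "Re (c * u ^ N) \<noteq> 0"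
  proof (cases "Re c = 0")
    case False
    thus ?thesis using that[of 1] by simp
  next
    case True
    hence Im: "Im c \<noteq> 0" using c by (auto simp: complex_eq_iff)
    \<comment> \<open>For a purely imaginary leading coefficient this angle turns
      \<open>u ^ N\<close> by exactly pi/4, while \<open>u\<close> stays within pi/4 of the positive
      axis.\<close>
    define t where "t = pi / (4 * real N)"
    have t: "0 < t" "t \<le> pi / 4" using N by (auto simp: t_def field_simps)
    have Nt: "real N * t = pi / 4" using N by (simp add: t_def field_simps)
    have "cis t ^ N = cis (real N * t)" using Complex.DeMoivre[of t N] by simp
    also have "\<dots> = cis (pi / 4)" by (simp only: Nt)
    finally have "cis t ^ N = cis (pi / 4)" .
    moreover have "cos t > 0" using t by (intro cos_gt_zero_pi) (use pi_gt_zero in linarith)+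
    ultimately show ?thesis using True Im by (intro that[of "cis t"]) (auto simp: sin_45)
  qed
  define \<kappa> where "\<kappa> = \<bar>Re (c * u ^ N)\<bar> / 2"
  have \<kappa>: "\<kappa> > 0" using u by (simp add: \<kappa>_def)
  have lim: "((\<lambda>t::real. poly p (of_real t * u) / of_real t ^ N) \<longlongrightarrow> c * u ^ N) at_top"
  proof (rule Lim_transform_eventually)
    have "((\<lambda>t::real. \<Sum>i\<le>N. coeff p i * u ^ i * of_real (t ^ i / t ^ N)) \<longlongrightarrow>
           (\<Sum>i\<le>N. coeff p i * u ^ i * of_real (if i = N then 1 else 0))) at_top"
    proof (intro tendsto_intros)
      fix i assume "i \<in> {..N}"
      hence i: "i \<le> N" by simp
      show "((\<lambda>t::real. t ^ i / t ^ N) \<longlongrightarrow> (if i = N then 1 else 0)) at_top"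
      proof (cases "i = N")
        case True
        have "eventually (\<lambda>t::real. 1 = t ^ i / t ^ N) at_top"
          using eventually_gt_at_top[of 0] by eventually_elim (simp add: True)
        thus ?thesis using True by (auto intro: tendsto_eventually elim: eventually_mono)
      next
        case False
        hence "N - i > 0" using i by simp
        hence "((\<lambda>t::real. inverse (t ^ (N - i))) \<longlongrightarrow> 0) at_top"
          by (intro tendsto_inverse_0_at_top filterlim_pow_at_top filterlim_ident)
        moreover have "eventually (\<lambda>t::real. inverse (t ^ (N - i)) = t ^ i / t ^ N) at_top"
          using eventually_gt_at_top[of 0]
          by eventually_elim (use i in \<open>simp add: power_diff field_simps\<close>)
        ultimately show ?thesis using False by (auto intro: Lim_transform_eventually)
      qed
    qed
    also have "(\<Sum>i\<le>N. coeff p i * u ^ i * of_real (if i = N then 1 else 0)) =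
               (\<Sum>i\<le>N. if i = N then coeff p i * u ^ i else 0)" by (intro sum.cong) auto
    also have "\<dots> = c * u ^ N" by (simp add: c_def N_def)
    finally show "((\<lambda>t::real. \<Sum>i\<le>N. coeff p i * u ^ i * of_real (t ^ i / t ^ N)) \<longlongrightarrow> c * u ^ N) at_top" .
    show "eventually (\<lambda>t::real. (\<Sum>i\<le>N. coeff p i * u ^ i * of_real (t ^ i / t ^ N)) =
            poly p (of_real t * u) / of_real t ^ N) at_top"
      by (intro always_eventually allI)
         (simp add: poly_altdef N_def sum_divide_distrib power_mult_distrib mult_ac)
  qed
  hence lim: "((\<lambda>t::real. Re (poly p (of_real t * u) / of_real t ^ N)) \<longlongrightarrow> Re (c * u ^ N)) at_top"
    by (intro tendsto_intros)
  have Re_div: "Re (poly p (of_real t * u) / of_real t ^ N) = Re (poly p (of_real t * u)) / t ^ N" for t :: real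
    by (simp flip: of_real_power)
  have pow: "t \<le> t ^ N" if "t \<ge> 1" for t :: real using that N by (simp add: self_le_power)
  have "eventually (\<lambda>t. Re (poly p (of_real t * u)) \<ge> \<kappa> * t) at_top \<or>
        eventually (\<lambda>t. Re (poly p (of_real t * u)) \<le> - \<kappa> * t) at_top"
  proof (cases "Re (c * u ^ N) > 0")
    case True
    hence "eventually (\<lambda>t. Re (poly p (of_real t * u) / of_real t ^ N) > \<kappa>) at_top"
      by (intro order_tendstoD(1)[OF lim]) (simp add: \<kappa>_def)
    hence "eventually (\<lambda>t. Re (poly p (of_real t * u)) \<ge> \<kappa> * t) at_top"
      using eventually_ge_at_top[of 1]
    proof eventually_elim
      case (elim t)
      have "\<kappa> * t \<le> \<kappa> * t ^ N" using pow[OF elim(2)] \<kappa> by simp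
      also have "\<dots> \<le> Re (poly p (of_real t * u))" using elim unfolding Re_div by (simp add: field_simps)
      finally show ?case .
    qed
    thus ?thesis ..
  next
    case False
    hence "eventually (\<lambda>t. Re (poly p (of_real t * u) / of_real t ^ N) < - \<kappa>) at_top"
    proof (intro order_tendstoD(2)[OF lim])
      show "Re (c * u ^ N) < - \<kappa>" using False u(3) unfolding \<kappa>_def by linarith
    qed
    hence "eventually (\<lambda>t. Re (poly p (of_real t * u)) \<le> - \<kappa> * t) at_top"
      using eventually_ge_at_top[of 1]
    proof eventually_elim
      case (elim t)
      have "Re (poly p (of_real t * u)) \<le> - \<kappa> * t ^ N" using elim unfolding Re_div by (simp add: field_simps)
      also have "\<dots> \<le> - \<kappa> * t" using pow[OF elim(2)] \<kappa> by simp
      finally show ?case .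
    qed
    thus ?thesis ..
  qed
  thus ?thesis by (rule that[OF u(1,2) \<kappa>])
qed

section \<open>Genus zero products\<close>

text \<open>The type is zero because finitely many factors form a polynomial, while the others
  contribute at most the exponential of \<open>norm z\<close> times a tail of the convergent sum,
  and that tail can be made as small as desired.\<close>

lemma entire_product:
  fixes a :: "nat \<Rightarrow> complex"
  assumes a: "\<And>n. a n \<noteq> 0" and sum: "summable (\<lambda>n. 1 / norm (a n))"
  obtains P where "P holomorphic_on UNIV" "min_exp_type P" "\<And>z. zorder P z = card (a -` {z})" "P 0 = 1"
proof -
  have lim0: "(\<lambda>n. 1 / norm (a n)) \<longlonglongrightarrow> 0" using sum by (rule summable_LIMSEQ_zero)
  have "filterlim (\<lambda>n. inverse (1 / norm (a n))) at_top at_top"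
    by (rule filterlim_inverse_at_top[OF lim0]) (use a in auto)
  hence flim: "filterlim a at_infinity at_top"
    by (intro filterlim_norm_at_top_imp_at_infinity) simp
  \<comment> \<open>With all exponents equal to 0 the Weierstrass factors are plain
    \<open>1 - z / a n\<close>.\<close>
  interpret weierstrass_product a "\<lambda>_. 0"
  proof
    show "summable (\<lambda>n. (r / norm (a n)) ^ Suc 0)" for r
      using summable_mult[OF sum, of r] by simp
  qed (use a flim in auto)
  define b where "b = (\<lambda>n. 1 / norm (a n))"
  have b: "b n \<ge> 0" for n by (simp add: b_def)
  have tends: "(\<lambda>n. \<Prod>i\<le>n. 1 - z / a i) \<longlonglongrightarrow> f z" for z
    using has_prod_imp_tendsto[OF has_prod, of z] by (simp add: weierstrass_factor_def)
  have "min_exp_type f"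
    unfolding min_exp_type_def
  proof (intro allI impI)
    fix \<epsilon> :: real assume \<epsilon>: "\<epsilon> > 0"
    have sumb: "summable b" using sum by (simp add: b_def)
    obtain M where M: "\<And>n. n \<ge> M \<Longrightarrow> norm (\<Sum>i. b (i + n)) < \<epsilon> / 2"
      using suminf_exist_split[OF _ sumb, of "\<epsilon>/2"] \<epsilon> by auto
    have "min_exp_type (\<lambda>z. \<Prod>i<M. 1 - z / a i)"
      by (rule min_exp_type_prod) (use min_exp_type_linear[of 1 "- 1 / a i" for i] in auto)
    then obtain C where C: "C > 0" "\<And>z. norm (\<Prod>i<M. 1 - z / a i) \<le> C * exp (\<epsilon>/2 * norm z)"
      using min_exp_typeE[of _ "\<epsilon>/2"] \<epsilon> by (metis half_gt_zero)
    have "norm (f z) \<le> C * exp (\<epsilon> * norm z)" for z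
    proof (rule Lim_norm_ubound[OF _ tends])
      show "eventually (\<lambda>n. norm (\<Prod>i\<le>n. 1 - z / a i) \<le> C * exp (\<epsilon> * norm z)) sequentially"
        using eventually_ge_at_top[of M]
      proof eventually_elim
        case (elim n)
        have "(\<Sum>i\<in>{M..n}. b i) = (\<Sum>i\<in>{..n-M}. b (i + M))"
          using elim by (intro sum.reindex_bij_witness[of _ "\<lambda>i. i + M" "\<lambda>i. i - M"]) auto
        also have "\<dots> \<le> (\<Sum>i. b (i + M))"
          using b sumb by (intro sum_le_suminf) (auto simp: summable_iff_shift)
        also have "\<dots> \<le> \<epsilon> / 2" using M[of M] by simp
        finally have S: "(\<Sum>i\<in>{M..n}. b i) \<le> \<epsilon> / 2" .
        have "norm (\<Prod>i\<in>{M..n}. 1 - z / a i) = (\<Prod>i\<in>{M..n}. norm (1 - z / a i))"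
          by (simp add: prod_norm)
        also have "\<dots> \<le> (\<Prod>i\<in>{M..n}. exp (norm z * b i))"
        proof (intro prod_mono conjI)
          fix i
          have "norm (1 - z / a i) \<le> 1 + norm z * b i"
            using norm_triangle_ineq4[of 1 "z / a i"] by (simp add: b_def norm_divide)
          also have "\<dots> \<le> exp (norm z * b i)" by (rule exp_ge_add_one_self)
          finally show "norm (1 - z / a i) \<le> exp (norm z * b i)" .
        qed auto
        also have "\<dots> = exp (norm z * (\<Sum>i\<in>{M..n}. b i))" by (simp add: exp_sum sum_distrib_left)
        also have "\<dots> \<le> exp (norm z * (\<epsilon> / 2))" using mult_left_mono[OF S, of "norm z"] by simp
        finally have tail: "norm (\<Prod>i\<in>{M..n}. 1 - z / a i) \<le> exp (norm z * (\<epsilon> / 2))" .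
        have split: "{..n} = {..<M} \<union> {M..n}" using elim by auto
        have "(\<Prod>i\<le>n. 1 - z / a i) = (\<Prod>i<M. 1 - z / a i) * (\<Prod>i\<in>{M..n}. 1 - z / a i)"
          unfolding split by (rule prod.union_disjoint) auto
        hence "norm (\<Prod>i\<le>n. 1 - z / a i) \<le> (C * exp (\<epsilon>/2 * norm z)) * exp (norm z * (\<epsilon> / 2))"
          unfolding norm_mult[symmetric] using C tail by (simp add: norm_mult mult_mono less_imp_le)
        also have "\<dots> = C * exp (\<epsilon> * norm z)"
          by (simp add: mult.assoc exp_add[symmetric] field_simps)
        finally show ?case .
      qed
    qed auto
    thus "\<exists>C. \<forall>z. norm (f z) \<le> C * exp (\<epsilon> * norm z)" by blast
  qed
  moreover have "f 0 = 1" using tends[of 0] by (simp add: LIMSEQ_const_iff)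
  ultimately show ?thesis using that holomorphic zorder by blast
qed

text \<open>The multiplicity function is unrolled into a sequence: a zero \<open>g\<close> is
  represented by the pairs \<open>(g, i)\<close> with \<open>i < m g\<close>. Summability makes the
  set of pairs countable and infinitude lets \<open>nat\<close> enumerate it bijectively, so the
  fibres of the sequence count multiplicities.\<close>

lemma entire_with_zeros:
  fixes m :: "complex \<Rightarrow> nat"
  assumes m0: "m 0 = 0" and sum: "(\<lambda>g. real (m g) / norm g) summable_on UNIV"
    and inf: "infinite {g. m g > 0}"
  obtains P where "P holomorphic_on UNIV" "min_exp_type P" "\<And>z. zorder P z = int (m z)" "P 0 = 1"
proof -
  define S where "S = (SIGMA g:{g. m g > 0}. {..<m g})"
  have "{g. m g > 0} = {g\<in>UNIV. real (m g) / norm g \<noteq> 0}" using m0 by (auto intro: gr0I)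
  hence "countable {g. m g > 0}" using summable_countable_real[OF sum] by simp
  hence countS: "countable S" unfolding S_def by (intro countable_SIGMA) auto
  have "fst ` S = {g. m g > 0}" by (force simp: S_def image_iff)
  hence infS: "infinite S" using inf by (metis finite_imageI)
  define e where "e = from_nat_into S"
  have bij: "bij_betw e UNIV S" unfolding e_def using countS infS by (rule bij_betw_from_nat_into)
  have eS: "e n \<in> S" for n using bij by (auto simp: bij_betw_def)
  define a where "a = (\<lambda>n. fst (e n))"
  have a: "a n \<noteq> 0" for n
  proof -
    have "m (fst (e n)) > 0" using eS[of n] by (auto simp: S_def)
    thus ?thesis using m0 by (auto simp: a_def)
  qed
  have sumS: "(\<lambda>x. 1 / norm (fst x)) summable_on S"
  proof (rule nonneg_bdd_above_summable_on)
    show "bdd_above (sum (\<lambda>x. 1 / norm (fst x)) ` {F. F \<subseteq> S \<and> finite F})"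
    proof (rule bdd_aboveI2)
      fix F assume F: "F \<in> {F. F \<subseteq> S \<and> finite F}"
      have "(\<Sum>x\<in>F. 1 / norm (fst x)) \<le> (\<Sum>x\<in>(SIGMA g:fst ` F. {..<m g}). 1 / norm (fst x))"
      proof (intro sum_mono2)
        show "F \<subseteq> (SIGMA g:fst ` F. {..<m g})"
        proof
          fix x assume "x \<in> F"
          moreover hence "x \<in> S" using F by auto
          ultimately show "x \<in> (SIGMA g:fst ` F. {..<m g})" by (cases x) (force simp: S_def)
        qed
      qed (use F in auto)
      also have "\<dots> = (\<Sum>g\<in>fst ` F. \<Sum>i<m g. 1 / norm g)"
        using F by (subst sum.Sigma) (auto simp: case_prod_beta)
      also have "\<dots> = (\<Sum>g\<in>fst ` F. real (m g) / norm g)" by simp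
      also have "\<dots> \<le> (\<Sum>\<^sub>\<infinity>g. real (m g) / norm g)"
        using F by (intro finite_sum_le_infsum sum) auto
      finally show "(\<Sum>x\<in>F. 1 / norm (fst x)) \<le> (\<Sum>\<^sub>\<infinity>g. real (m g) / norm g)" .
    qed
  qed auto
  have "(\<lambda>n. 1 / norm (fst (e n))) summable_on UNIV"
    using summable_on_reindex_bij_betw[OF bij, of "\<lambda>x. 1 / norm (fst x)"] sumS by simp
  hence "summable (\<lambda>n. 1 / norm (a n))" unfolding a_def by (rule summable_on_imp_summable)
  then obtain P where P: "P holomorphic_on UNIV" "min_exp_type P" "\<And>z. zorder P z = card (a -` {z})" "P 0 = 1"
    using entire_product[of a] a by metis
  have "card (a -` {z}) = m z" for z
  proof -
    have inj: "inj e" and ran: "range e = S" using bij by (auto simp: bij_betw_def)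
    have "a -` {z} = e -` ({z} \<times> {..<m z})"
    proof (intro set_eqI iffI)
      fix n assume n: "n \<in> a -` {z}"
      have "e n \<in> S" by (rule eS)
      thus "n \<in> e -` ({z} \<times> {..<m z})" using n unfolding S_def a_def by (cases "e n") auto
    qed (auto simp: a_def)
    also have "card \<dots> = card ({z} \<times> {..<m z})"
    proof (rule card_vimage_inj[OF inj])
      show "{z} \<times> {..<m z} \<subseteq> range e" unfolding ran by (auto simp: S_def)
    qed
    also have "\<dots> = m z" by simp
    finally show ?thesis .
  qed
  thus ?thesis using P that by simp
qed

section \<open>Quotients with few zeros and poles\<close>

lemma entire_eventually_nonzero:
  assumes "f holomorphic_on UNIV" "f w \<noteq> 0"
  shows "eventually (\<lambda>w. f w \<noteq> 0) (at z)"
  using non_zero_neighbour_alt[of f UNIV z w] assms by (auto elim: eventually_mono)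

lemma zorder_mult_entire:
  assumes "f holomorphic_on UNIV" "g holomorphic_on UNIV" "f w \<noteq> 0" "g w \<noteq> 0"
  shows "zorder (\<lambda>z. f z * g z) z = zorder f z + zorder g z"
proof (rule zorder_times_analytic)
  show "eventually (\<lambda>z. f z * g z \<noteq> 0) (at z)"
    using entire_eventually_nonzero[OF assms(1,3), of z] entire_eventually_nonzero[OF assms(2,4), of z]
    by eventually_elim auto
qed (use assms in \<open>auto simp: analytic_on_holomorphic\<close>)

lemma zorder_entire_pos_iff:
  assumes "f holomorphic_on UNIV" "f w \<noteq> 0"
  shows "zorder f z > 0 \<longleftrightarrow> f z = 0" and "zorder f z \<ge> 0"
proof -
  have ev: "frequently (\<lambda>w. f w \<noteq> 0) (at z)"
    using entire_eventually_nonzero[OF assms, of z] by (intro eventually_frequently) auto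
  show "zorder f z > 0 \<longleftrightarrow> f z = 0"
    using assms ev by (intro zorder_pos_iff) auto
  have "f analytic_on {z}" using assms(1) by (auto simp: analytic_on_holomorphic)
  thus "zorder f z \<ge> 0" using ev by (rule zorder_ge_0)
qed

lemma summable_on_inverse_powers_of_two:
  "(\<lambda>g. real (if g \<in> range (\<lambda>n::nat. 2 ^ n :: complex) then 1 else 0) / norm g) summable_on UNIV"
proof -
  have inj: "inj (\<lambda>n::nat. 2 ^ n :: complex)"
  proof (rule injI)
    fix m n :: nat assume "(2 ^ m :: complex) = 2 ^ n"
    hence "norm ((2::complex) ^ m) = norm ((2::complex) ^ n)" by simp
    hence "(2::real) ^ m = 2 ^ n" by (simp add: norm_power)
    thus "m = n" by simp
  qed
  have "summable (\<lambda>n. (1/2 :: real) ^ n)" by (rule summable_geometric) auto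
  hence "(\<lambda>n. (1/2 :: real) ^ n) summable_on UNIV" by (simp add: summable_on_UNIV_nonneg_real_iff)
  hence "((\<lambda>g. 1 / norm g) \<circ> (\<lambda>n. 2 ^ n :: complex)) summable_on UNIV"
    by (simp add: o_def norm_power power_one_over)
  hence "(\<lambda>g::complex. 1 / norm g) summable_on range (\<lambda>n. 2 ^ n)"
    using summable_on_reindex[OF inj, of "\<lambda>g. 1 / norm g"] by simp
  thus ?thesis by (rule summable_on_cong_neutral[THEN iffD1, rotated 3]) auto
qed

text \<open>Common extra zeros at the powers of 2 are harmless and make both zero sets infinite, so that
  they can be enumerated by the natural numbers.\<close>
lemma entire_with_zeros_padded:
  fixes \<phi> :: "complex \<Rightarrow> complex"
  assumes sum: "(\<lambda>g. real (nat (zorder \<phi> g)) / norm g) summable_on \<Gamma>" and zero: "zorder \<phi> 0 = 0"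
  obtains P where "P holomorphic_on UNIV" "min_exp_type P" "P 0 = 1"
    "\<And>z. zorder P z = int (if z \<in> \<Gamma> then nat (zorder \<phi> z) else 0) + (if z \<in> range (\<lambda>n::nat. 2 ^ n) then 1 else 0)"
proof -
  define D where "D = range (\<lambda>n::nat. 2 ^ n :: complex)"
  define m where "m = (\<lambda>g. (if g \<in> \<Gamma> then nat (zorder \<phi> g) else 0) + (if g \<in> D then 1 else 0 :: nat))"
  have "0 \<notin> D" by (auto simp: D_def)
  hence m0: "m 0 = 0" using zero by (simp add: m_def)
  have "(\<lambda>g. real (if g \<in> \<Gamma> then nat (zorder \<phi> g) else 0) / norm g) summable_on UNIV"
    using sum by (rule summable_on_cong_neutral[THEN iffD1, rotated 3]) auto
  from summable_on_add[OF this summable_on_inverse_powers_of_two]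
  have "(\<lambda>g. real (m g) / norm g) summable_on UNIV"
    by (simp add: m_def D_def add_divide_distrib)
  moreover have "infinite {g. m g > 0}"
  proof
    assume "finite {g. m g > 0}"
    moreover have "D \<subseteq> {g. m g > 0}" by (auto simp: m_def)
    ultimately have fin: "finite D" using finite_subset by blast
    hence "finite (norm ` D)" by simp
    moreover have "norm ` D = range (\<lambda>n::nat. 2 ^ n :: real)"
      by (auto simp: D_def norm_power image_image)
    moreover have "inj (\<lambda>n::nat. 2 ^ n :: real)" by (auto intro: injI)
    ultimately show False using finite_imageD by fastforce
  qed
  ultimately obtain P where P: "P holomorphic_on UNIV" "min_exp_type P" "\<And>z. zorder P z = int (m z)" "P 0 = 1"
    using entire_with_zeros[where m = m] m0 by metis
  show ?thesis using P(1,2,4)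
  proof (rule that)
    show "zorder P z = int (if z \<in> \<Gamma> then nat (zorder \<phi> z) else 0) + (if z \<in> range (\<lambda>n::nat. 2 ^ n) then 1 else 0)" for z
      unfolding P(3) m_def D_def by simp
  qed
qed

text \<open>\<open>P\<close> carries the zeros of \<open>\<phi>\<close> in \<open>\<Gamma>\<close>
  and \<open>R\<close> those of \<open>\<psi>\<close>; outside \<open>\<Gamma>\<close> the orders
  agree already. Hence \<open>\<phi> * R\<close> and \<open>\<psi> * P\<close> have the same order
  everywhere and differ by a zero-free factor \<open>exp h\<close>. The origin is a point where
  neither function vanishes, which permits the normalisation \<open>P 0 = R 0 = 1\<close>.\<close>

theorem entire_ratio_constant:
  fixes \<phi> \<psi> :: "complex \<Rightarrow> complex"
  assumes hol: "\<phi> holomorphic_on UNIV" "\<psi> holomorphic_on UNIV"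
    and fin: "fin_order \<phi>" "fin_order \<psi>" and nz: "\<phi> 0 \<noteq> 0" "\<psi> 0 \<noteq> 0"
    and zo: "\<And>z. z \<notin> \<Gamma> \<Longrightarrow> zorder \<phi> z = zorder \<psi> z"
    and sum1: "(\<lambda>g. real (nat (zorder \<phi> g)) / norm g) summable_on \<Gamma>"
    and sum2: "(\<lambda>g. real (nat (zorder \<psi> g)) / norm g) summable_on \<Gamma>"
    and q: "q \<noteq> 0" and \<delta>: "\<delta> > 0"
    and psi: "\<And>z. Re z \<ge> 0 \<Longrightarrow> \<psi> z \<noteq> 0"
    and ratio: "\<And>z. Re z \<ge> 0 \<Longrightarrow> norm (\<phi> z / \<psi> z - q) \<le> C * exp (- \<delta> * Re z)"
  shows "\<phi> z = q * \<psi> z"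
proof -
  have "zorder \<phi> 0 = 0" "zorder \<psi> 0 = 0"
    using zorder_entire_pos_iff[OF hol(1) nz(1), of 0] zorder_entire_pos_iff[OF hol(2) nz(2), of 0] nz by linarith+
  note z0 = this
  obtain P where P: "P holomorphic_on UNIV" "min_exp_type P" "P 0 = 1"
    "\<And>z. zorder P z = int (if z \<in> \<Gamma> then nat (zorder \<phi> z) else 0) + (if z \<in> range (\<lambda>n::nat. 2 ^ n) then 1 else 0)"
    by (rule entire_with_zeros_padded[OF sum1 z0(1)]) (rule that)
  obtain R where R: "R holomorphic_on UNIV" "min_exp_type R" "R 0 = 1"
    "\<And>z. zorder R z = int (if z \<in> \<Gamma> then nat (zorder \<psi> z) else 0) + (if z \<in> range (\<lambda>n::nat. 2 ^ n) then 1 else 0)"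
    by (rule entire_with_zeros_padded[OF sum2 z0(2)]) (rule that)
  define F where "F = (\<lambda>z. \<phi> z * R z)"
  define H where "H = (\<lambda>z. \<psi> z * P z)"
  have holF: "F holomorphic_on UNIV" unfolding F_def by (intro holomorphic_intros hol R)
  have holH: "H holomorphic_on UNIV" unfolding H_def by (intro holomorphic_intros hol P)
  have F0: "F 0 \<noteq> 0" and H0: "H 0 \<noteq> 0" using nz P(3) R(3) by (auto simp: F_def H_def)
  have zoF: "zorder F z = zorder \<phi> z + zorder R z" for z
    unfolding F_def by (rule zorder_mult_entire[of _ _ 0]) (use hol R nz in auto)
  have zoH: "zorder H z = zorder \<psi> z + zorder P z" for z
    unfolding H_def by (rule zorder_mult_entire[of _ _ 0]) (use hol P nz in auto)
  have zo_eq: "zorder H z = zorder F z" for z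
    using zo[of z] zorder_entire_pos_iff(2)[OF hol(1) nz(1), of z] zorder_entire_pos_iff(2)[OF hol(2) nz(2), of z]
    unfolding zoF zoH P(4) R(4) by (cases "z \<in> \<Gamma>") auto
  have zeros: "H z = 0 \<longleftrightarrow> F z = 0" for z
    using zorder_entire_pos_iff(1)[OF holF F0, of z] zorder_entire_pos_iff(1)[OF holH H0, of z]
    by (simp add: zo_eq)
  obtain Z where Z: "Z holomorphic_on UNIV" "\<And>z. Z z \<noteq> 0" "\<And>z. F z = Z z * H z"
    using holomorphic_zorder_factorization[of F UNIV H] holF holH zeros zo_eq by auto
  obtain h where h: "h holomorphic_on UNIV" "\<And>z. Z z = exp (h z)"
    using contractible_imp_holomorphic_log[of Z UNIV] Z(1,2) by auto
  have FH: "F z = H z * exp (h z)" for z using Z(3) h(2) by (simp add: mult.commute)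
  have "fin_order F" "fin_order H"
    unfolding F_def H_def by (intro fin_order_mult fin fin_order_of_min_exp_type P(2) R(2))+
  then obtain A n where A: "\<And>z. Re (h z) < A * (1 + norm z) ^ n"
    using exponent_growth[OF holF holH h(1) FH H0] by metis
  obtain p where p: "\<And>z. h z = poly p z"
    by (rule entire_Re_growth_imp_poly[OF h(1) A]) (rule that)
  define r where "r = (\<lambda>z. \<phi> z / \<psi> z)"
  \<comment> \<open>Kept free of division by \<open>R\<close>, which vanishes in the half plane at
    the powers of 2.\<close>
  have rR: "r z * R z = P z * exp (h z)" if "Re z \<ge> 0" for z
    using FH[of z] psi[OF that] by (simp add: F_def H_def r_def field_simps)
  have contP: "continuous_on UNIV P" and contR: "continuous_on UNIV R"
    using P(1) R(1) by (auto intro: holomorphic_on_imp_continuous_on)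
  have "degree p = 0"
  proof (rule ccontr)
    assume "degree p \<noteq> 0"
    then obtain u \<kappa> where u: "norm u = 1" "Re u > 0" "\<kappa> > 0"
      "eventually (\<lambda>t. Re (poly p (of_real t * u)) \<ge> \<kappa> * t) at_top \<or>
       eventually (\<lambda>t. Re (poly p (of_real t * u)) \<le> - \<kappa> * t) at_top"
      using poly_Re_on_ray[of p] by auto
    have lim: "((\<lambda>t. r (of_real t * u)) \<longlongrightarrow> q) at_top"
    proof (rule Lim_null_comparison[THEN LIM_zero_cancel])
      show "eventually (\<lambda>t. norm (r (of_real t * u) - q) \<le> C * exp (- \<delta> * (t * Re u))) at_top"
        using eventually_ge_at_top[of 0]
      proof eventually_elim
        case (elim t)
        thus ?case using ratio[of "of_real t * u"] u by (simp add: r_def)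
      qed
      show "((\<lambda>t. C * exp (- \<delta> * (t * Re u))) \<longlongrightarrow> 0) at_top" using \<delta> u(2) by real_asymp
    qed
    hence limn: "((\<lambda>t. norm (r (of_real t * u))) \<longlongrightarrow> norm q) at_top" by (rule tendsto_norm)
    have ev: "eventually (\<lambda>t. norm (r (of_real t * u)) > norm q / 2) at_top"
             "eventually (\<lambda>t. norm (r (of_real t * u)) < 2 * norm q) at_top"
      by (rule order_tendstoD(1)[OF limn], use q in simp) (rule order_tendstoD(2)[OF limn], use q in simp)
    have k2: "\<kappa> / 2 > 0" using u by simp
    from u(4) show False
    proof
      \<comment> \<open>Here \<open>P = r * R * exp (- h)\<close> with \<open>r\<close> bounded
        above: the rate \<open>\<kappa>\<close> beats the type \<open>\<kappa> / 2\<close> granted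
        to \<open>R\<close>, so \<open>P\<close> decays.\<close>
      assume ge: "eventually (\<lambda>t. Re (poly p (of_real t * u)) \<ge> \<kappa> * t) at_top"
      obtain K where K: "K > 0" "\<And>z. norm (R z) \<le> K * exp (\<kappa> / 2 * norm z)"
        using min_exp_typeE[OF R(2) k2] by metis
      have "eventually (\<lambda>t. norm (P (of_real t * u)) \<le> (2 * norm q * K) * exp (- (\<kappa> / 2) * t)) at_top"
        using ge ev(2) eventually_ge_at_top[of 0]
      proof eventually_elim
        case (elim t)
        define w where "w = of_real t * u"
        have w: "Re w \<ge> 0" "norm w = t" using elim u by (auto simp: w_def norm_mult)
        have "norm (P w) * exp (Re (h w)) = norm (r w) * norm (R w)"
          using arg_cong[OF rR[OF w(1)], of norm] by (simp add: norm_mult)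
        also have "\<dots> \<le> (2 * norm q) * (K * exp (\<kappa> / 2 * t))"
          using elim(2) K(2)[of w] w by (intro mult_mono) (auto simp: w_def)
        finally have 1: "norm (P w) * exp (Re (h w)) \<le> (2 * norm q) * (K * exp (\<kappa> / 2 * t))" .
        have "norm (P w) * exp (\<kappa> * t) \<le> norm (P w) * exp (Re (h w))"
          using elim(1) p by (intro mult_left_mono) (auto simp: w_def)
        with 1 have "norm (P w) * exp (\<kappa> * t) \<le> (2 * norm q) * (K * exp (\<kappa> / 2 * t))" by linarith
        hence "norm (P w) \<le> (2 * norm q) * (K * exp (\<kappa> / 2 * t)) * exp (- \<kappa> * t)"
          by (simp add: exp_minus field_simps)
        also have "\<dots> = (2 * norm q * K) * exp (- (\<kappa> / 2) * t)"
          by (simp add: mult.assoc exp_add[symmetric])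
        finally show ?case by (simp add: w_def)
      qed
      hence "exp_decay P u" by (rule exp_decayI_eventually[OF contP k2])
      hence "P 0 = 0" using min_exp_type_decay_eq_0[OF P(1,2)] u by blast
      thus False using P(3) by simp
    next
      \<comment> \<open>Now the roles are exchanged: \<open>r\<close> is bounded away from 0, and
        \<open>R = P * exp h / r\<close> decays.\<close>
      assume le: "eventually (\<lambda>t. Re (poly p (of_real t * u)) \<le> - \<kappa> * t) at_top"
      obtain K where K: "K > 0" "\<And>z. norm (P z) \<le> K * exp (\<kappa> / 2 * norm z)"
        using min_exp_typeE[OF P(2) k2] by metis
      have "eventually (\<lambda>t. norm (R (of_real t * u)) \<le> (2 / norm q * K) * exp (- (\<kappa> / 2) * t)) at_top"
        using le ev(1) eventually_ge_at_top[of 0]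
      proof eventually_elim
        case (elim t)
        define w where "w = of_real t * u"
        have w: "Re w \<ge> 0" "norm w = t" using elim u by (auto simp: w_def norm_mult)
        have "norm q / 2 * norm (R w) \<le> norm (r w) * norm (R w)"
          using elim(2) by (intro mult_right_mono) (auto simp: w_def)
        also have "\<dots> = norm (P w) * exp (Re (h w))"
          using arg_cong[OF rR[OF w(1)], of norm] by (simp add: norm_mult)
        also have "\<dots> \<le> (K * exp (\<kappa> / 2 * t)) * exp (- \<kappa> * t)"
          using elim(1) K(1) K(2)[of w] w p by (intro mult_mono) (auto simp: w_def)
        also have "\<dots> = K * exp (- (\<kappa> / 2) * t)"
          by (simp add: mult.assoc exp_add[symmetric])
        finally show ?case using q by (simp add: w_def field_simps)
      qed
      hence "exp_decay R u" by (rule exp_decayI_eventually[OF contR k2])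
      hence "R 0 = 0" using min_exp_type_decay_eq_0[OF R(1,2)] u by blast
      thus False using R(3) by simp
    qed
  qed
  then obtain c where "p = [:c:]" by (metis degree_eq_zeroE)
  define k where "k = exp c"
  have rR: "r z * R z = k * P z" if "Re z \<ge> 0" for z
    using rR[OF that] p[of z] \<open>p = [:c:]\<close> by (simp add: k_def mult.commute)
  \<comment> \<open>On the positive axis \<open>E = R * (r - q)\<close>; the rate
    \<open>\<delta>\<close> of the quotient against a type \<open>\<delta> / 2\<close> granted to
    \<open>R\<close> leaves decay at rate \<open>\<delta> / 2\<close>.\<close>
  define E where "E = (\<lambda>z. k * P z - q * R z)"
  have "E w = 0" for w
  proof (rule min_exp_type_decay_eq_0[where P = E and u = 1])
    show holE: "E holomorphic_on UNIV" unfolding E_def by (intro holomorphic_intros P R)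
    show "min_exp_type E" unfolding E_def
      by (intro min_exp_type_diff min_exp_type_mult min_exp_type_const P R)
    have d2: "\<delta> / 2 > 0" using \<delta> by simp
    obtain K where K: "K > 0" "\<And>z. norm (R z) \<le> K * exp (\<delta> / 2 * norm z)"
      using min_exp_typeE[OF R(2) d2] by metis
    show "exp_decay E 1"
      unfolding exp_decay_def
    proof (rule exI[of _ "K * C"], rule exI[of _ "\<delta> / 2"], intro conjI allI impI)
      fix t :: real assume t: "t \<ge> 0"
      have "E (of_real t) = R (of_real t) * (r (of_real t) - q)"
        using rR[of "of_real t"] t by (simp add: E_def algebra_simps)
      hence "norm (E (of_real t)) = norm (R (of_real t)) * norm (r (of_real t) - q)"
        by (simp add: norm_mult)
      also have "\<dots> \<le> (K * exp (\<delta> / 2 * t)) * (C * exp (- \<delta> * t))"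
        using K(2)[of "of_real t"] ratio[of "of_real t"] t K(1) by (intro mult_mono) (auto simp: r_def)
      also have "\<dots> = (K * C) * exp (- (\<delta> / 2) * t)"
      proof -
        have "exp (\<delta> / 2 * t) * exp (- \<delta> * t) = exp (- (\<delta> / 2) * t)"
          by (simp add: exp_add[symmetric])
        hence "K * C * (exp (\<delta> / 2 * t) * exp (- \<delta> * t)) = K * C * exp (- (\<delta> / 2) * t)"
          by (rule arg_cong)
        thus ?thesis by (simp only: mult_ac)
      qed
      finally show "norm (E (of_real t * 1)) \<le> (K * C) * exp (- (\<delta> / 2) * t)" by simp
    qed (use d2 in auto)
  qed auto
  hence kP: "k * P z = q * R z" for z by (simp add: E_def)
  have "(\<phi> z - q * \<psi> z) * R z = 0" for z
  proof -
    have "\<phi> z * R z = \<psi> z * (k * P z)"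
      using FH[of z] p[of z] \<open>p = [:c:]\<close> by (simp add: F_def H_def k_def mult_ac)
    thus ?thesis unfolding kP by (simp add: algebra_simps)
  qed
  note prod0 = this
  \<comment> \<open>The zeros of \<open>R\<close> are isolated, so it cancels in a punctured
    neighbourhood of \<open>z\<close>, and continuity carries the identity to \<open>z\<close>
    itself.\<close>
  have "eventually (\<lambda>w. R w \<noteq> 0) (at z)"
    using entire_eventually_nonzero[OF R(1), of 0 z] R(3) by simp
  hence "eventually (\<lambda>w. \<phi> w - q * \<psi> w = 0) (at z)"
  proof eventually_elim
    case (elim w)
    thus ?case using prod0[of w] by simp
  qed
  hence "((\<lambda>w. \<phi> w - q * \<psi> w) \<longlongrightarrow> 0) (at z)" by (rule tendsto_eventually)
  moreover have "(\<lambda>w. \<phi> w - q * \<psi> w) holomorphic_on UNIV" by (intro holomorphic_intros hol)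
  hence "isCont (\<lambda>w. \<phi> w - q * \<psi> w) z"
    by (meson UNIV_I continuous_on_eq_continuous_at holomorphic_on_imp_continuous_on open_UNIV)
  hence "((\<lambda>w. \<phi> w - q * \<psi> w) \<longlongrightarrow> \<phi> z - q * \<psi> z) (at z)" by (simp add: isCont_def)
  ultimately have "\<phi> z - q * \<psi> z = 0" by (intro tendsto_unique[of "at z"]) auto
  thus ?thesis by simp
qed

section \<open>Dirichlet series, counting functions and trivial zeros\<close>

text \<open>Once the constant \<alpha> and the first deviating term, at index \<open>N\<close>, are
  removed, only indices above \<open>N\<close> remain. Comparison with the absolutely convergent
  series at 2 then extracts the factor \<open>(N + 1) powr (2 - Re s)\<close>.\<close>

lemma dirichlet_asymptotic:
  fixes N :: nat
  assumes exp: "dirichlet_expansion a L" and N: "N \<ge> 1"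
    and zero: "\<And>n. 1 \<le> n \<Longrightarrow> n < N \<Longrightarrow> a n = (if n = 1 then \<alpha> else 0)"
  defines "c \<equiv> a N - (if N = 1 then \<alpha> else 0)"
  obtains B where "B > 0"
    "\<And>s. Re s \<ge> 2 \<Longrightarrow> norm (L s - \<alpha> - c * of_nat N powr (- s)) \<le> B * real (N + 1) powr (- Re s)"
proof -
  \<comment> \<open>\<open>b n\<close> belongs to the index \<open>Suc n\<close>; if
    \<open>N = 1\<close>, both corrections fall on the first coefficient and cancel it.\<close>
  define b where "b = (\<lambda>n. a (Suc n) - (if n = 0 then \<alpha> else 0) - (if Suc n = N then c else 0))"
  have b0: "b n = 0" if "Suc n \<le> N" for n
    using that zero[of "Suc n"] N by (cases "Suc n = N") (auto simp: b_def c_def)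
  have norm_powr: "norm (of_nat (Suc n) powr s) = real (Suc n) powr Re s" for n and s :: complex
    by (subst norm_powr_real_powr) auto
  have sums: "(\<lambda>n. b n * of_nat (Suc n) powr (- s)) sums (L s - \<alpha> - c * of_nat N powr (- s))"
    if "Re s > 1" for s
  proof -
    have "(\<lambda>n. a (Suc n) * of_nat (Suc n) powr (- s)) sums L s"
      using exp that unfolding dirichlet_expansion_def by blast
    moreover have "(\<lambda>n. if n = 0 then \<alpha> * of_nat (Suc n) powr (- s) else 0) sums (\<alpha> * of_nat (Suc 0) powr (- s))"
      by (rule sums_single)
    moreover have "(\<lambda>n. if n = N - 1 then c * of_nat (Suc n) powr (- s) else 0) sums (c * of_nat (Suc (N - 1)) powr (- s))"
      by (rule sums_single)
    ultimately have "(\<lambda>n. a (Suc n) * of_nat (Suc n) powr (- s) - (if n = 0 then \<alpha> * of_nat (Suc n) powr (- s) else 0)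
        - (if n = N - 1 then c * of_nat (Suc n) powr (- s) else 0)) sums
        (L s - \<alpha> * of_nat (Suc 0) powr (- s) - c * of_nat (Suc (N - 1)) powr (- s))"
      by (intro sums_diff)
    moreover have "(\<lambda>n. a (Suc n) * of_nat (Suc n) powr (- s) - (if n = 0 then \<alpha> * of_nat (Suc n) powr (- s) else 0)
        - (if n = N - 1 then c * of_nat (Suc n) powr (- s) else 0)) = (\<lambda>n. b n * of_nat (Suc n) powr (- s))"
      using N by (intro ext) (auto simp: b_def algebra_simps)
    ultimately show ?thesis using N by simp
  qed
  have absum: "summable (\<lambda>n. norm (b n * of_nat (Suc n) powr (- 2)))"
  proof -
    have "summable (\<lambda>n. norm (a (Suc n) * of_nat (Suc n) powr (- 2)))"
      using exp unfolding dirichlet_expansion_def by (elim allE[of _ 2]) auto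
    moreover have "summable (\<lambda>n. if n \<in> {0, N - 1} then norm (b n * of_nat (Suc n) powr (- 2)) else 0)"
      by (rule summable_If_finite_set) auto
    ultimately have s: "summable (\<lambda>n. norm (a (Suc n) * of_nat (Suc n) powr (- 2)) +
        (if n \<in> {0, N - 1} then norm (b n * of_nat (Suc n) powr (- 2)) else 0))"
      by (rule summable_add)
    show ?thesis
    proof (rule summable_comparison_test[OF _ s], intro exI allI impI)
      fix n
      show "norm (norm (b n * of_nat (Suc n) powr (- 2))) \<le> norm (a (Suc n) * of_nat (Suc n) powr (- 2)) +
        (if n \<in> {0, N - 1} then norm (b n * of_nat (Suc n) powr (- 2)) else 0)"
      proof (cases "n \<in> {0, N - 1}")
        case False
        hence "b n = a (Suc n)" by (auto simp: b_def)
        thus ?thesis using False by simp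
      qed auto
    qed
  qed
  define A where "A = (\<Sum>n. norm (b n * of_nat (Suc n) powr (- 2)))"
  have A0: "A \<ge> 0" unfolding A_def by (rule suminf_nonneg[OF absum]) auto
  have "norm (L s - \<alpha> - c * of_nat N powr (- s)) \<le> ((A + 1) * real (N + 1) powr 2) * real (N + 1) powr (- Re s)"
    if s: "Re s \<ge> 2" for s
  proof -
    have le: "norm (b n * of_nat (Suc n) powr (- s)) \<le>
        norm (b n * of_nat (Suc n) powr (- 2)) * real (N + 1) powr (2 - Re s)" for n
    proof (cases "Suc n \<le> N")
      case False
      have "norm (of_nat (Suc n) powr (- s) :: complex) = real (Suc n) powr (- 2) * real (Suc n) powr (2 - Re s)"
        unfolding norm_powr by (simp add: powr_add[symmetric])
      also have "real (Suc n) powr (2 - Re s) \<le> real (N + 1) powr (2 - Re s)"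
        using False s by (intro powr_mono2') auto
      hence "real (Suc n) powr (- 2) * real (Suc n) powr (2 - Re s) \<le>
             real (Suc n) powr (- 2) * real (N + 1) powr (2 - Re s)"
        by (intro mult_left_mono) auto
      finally have "norm (b n) * norm (of_nat (Suc n) powr (- s) :: complex) \<le>
          norm (b n) * (real (Suc n) powr (- 2) * real (N + 1) powr (2 - Re s))"
        by (intro mult_left_mono) auto
      moreover have "norm (of_nat (Suc n) powr (- 2) :: complex) = real (Suc n) powr (- 2)"
        unfolding norm_powr by simp
      ultimately show ?thesis by (simp add: norm_mult mult.assoc)
    qed (simp add: b0)
    have sm: "summable (\<lambda>n. norm (b n * of_nat (Suc n) powr (- 2)) * real (N + 1) powr (2 - Re s))"
      by (rule summable_mult2[OF absum])
    have "norm (\<Sum>n. b n * of_nat (Suc n) powr (- s)) \<le>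
        (\<Sum>n. norm (b n * of_nat (Suc n) powr (- 2)) * real (N + 1) powr (2 - Re s))"
      by (rule norm_suminf_le[OF le sm])
    also have "\<dots> = A * real (N + 1) powr (2 - Re s)"
      unfolding A_def by (rule suminf_mult2[OF absum, symmetric])
    also have "\<dots> \<le> (A + 1) * real (N + 1) powr (2 - Re s)" by (intro mult_right_mono) auto
    also have "\<dots> = ((A + 1) * real (N + 1) powr 2) * real (N + 1) powr (- Re s)"
      by (simp only: mult.assoc powr_add[symmetric]) simp
    finally show ?thesis using sums[of s] s by (simp add: sums_iff)
  qed
  thus ?thesis using A0 by (intro that[of "(A + 1) * real (N + 1) powr 2"]) auto
qed

text \<open>The integral of \<open>1 / r ^ 2\<close> from \<open>norm s\<close> to infinity is
  \<open>1 / norm s\<close>. Each finite partial sum is therefore the integral of a finite sum that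
  the counting integrand dominates, which bounds all partial sums at once.\<close>

lemma counting_integral_summable:
  fixes \<mu> :: "complex \<Rightarrow> nat"
  assumes fin: "\<And>r. finite (G \<inter> cball 0 r)" and r0: "r0 > 0"
    and int: "(\<lambda>r. real (\<Sum>s\<in>G \<inter> cball 0 r. \<mu> s) / r\<^sup>2) integrable_on {r0..}"
  shows "(\<lambda>s. real (\<mu> s) / norm s) summable_on {s\<in>G. norm s \<ge> r0}"
proof (rule nonneg_bdd_above_summable_on)
  show "bdd_above (sum (\<lambda>s. real (\<mu> s) / norm s) ` {F. F \<subseteq> {s\<in>G. norm s \<ge> r0} \<and> finite F})"
  proof (rule bdd_aboveI2)
    fix F assume F: "F \<in> {F. F \<subseteq> {s\<in>G. norm s \<ge> r0} \<and> finite F}"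
    have "((\<lambda>r. real (\<mu> s) * (if r \<in> {norm s..} then 1 / r ^ 2 else 0)) has_integral (real (\<mu> s) * (1 / norm s))) {r0..}"
      if "s \<in> F" for s
    proof -
      have "norm s > 0" "norm s \<ge> r0" using that F r0 by auto
      hence "((\<lambda>r. 1 / r ^ 2) has_integral (1 / norm s)) {norm s..}"
        using has_integral_inverse_power_to_inf[of 2 "norm s"] by simp
      hence "((\<lambda>r. if r \<in> {norm s..} then 1 / r ^ 2 else 0) has_integral (1 / norm s)) {r0..}"
        using \<open>norm s \<ge> r0\<close> by (subst has_integral_restrict) auto
      thus ?thesis by (rule has_integral_mult_right)
    qed
    hence "((\<lambda>r. \<Sum>s\<in>F. real (\<mu> s) * (if r \<in> {norm s..} then 1 / r ^ 2 else 0)) has_integral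
            (\<Sum>s\<in>F. real (\<mu> s) * (1 / norm s))) {r0..}"
      using F by (intro has_integral_sum) auto
    moreover have "((\<lambda>r. real (\<Sum>s\<in>G \<inter> cball 0 r. \<mu> s) / r\<^sup>2) has_integral
        integral {r0..} (\<lambda>r. real (\<Sum>s\<in>G \<inter> cball 0 r. \<mu> s) / r\<^sup>2)) {r0..}"
      using int by (rule integrable_integral)
    ultimately have "(\<Sum>s\<in>F. real (\<mu> s) * (1 / norm s)) \<le>
        integral {r0..} (\<lambda>r. real (\<Sum>s\<in>G \<inter> cball 0 r. \<mu> s) / r\<^sup>2)"
    proof (rule has_integral_le)
      fix r assume r: "r \<in> {r0..}"
      have "(\<Sum>s\<in>F. real (\<mu> s) * (if r \<in> {norm s..} then 1 / r ^ 2 else 0)) =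
            (\<Sum>s\<in>F. if norm s \<le> r then real (\<mu> s) / r\<^sup>2 else 0)"
        by (intro sum.cong) auto
      also have "\<dots> = (\<Sum>s\<in>F \<inter> {s. norm s \<le> r}. real (\<mu> s) / r\<^sup>2)"
        using F by (subst sum.inter_restrict) auto
      also have "\<dots> \<le> (\<Sum>s\<in>G \<inter> cball 0 r. real (\<mu> s) / r\<^sup>2)"
        using F fin by (intro sum_mono2) auto
      also have "\<dots> = real (\<Sum>s\<in>G \<inter> cball 0 r. \<mu> s) / r\<^sup>2"
        by (simp add: sum_divide_distrib)
      finally show "(\<Sum>s\<in>F. real (\<mu> s) * (if r \<in> {norm s..} then 1 / r ^ 2 else 0)) \<le> \<dots>" .
    qed
    thus "(\<Sum>s\<in>F. real (\<mu> s) / norm s) \<le> integral {r0..} (\<lambda>r. real (\<Sum>s\<in>G \<inter> cball 0 r. \<mu> s) / r\<^sup>2)"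
      by simp
  qed
qed auto

section \<open>Trivial zeros forced by the Gamma factors\<close>

lemma Re_pos_not_nonpos_Ints:
  assumes "Re z > 0"
  shows "z \<notin> \<int>\<^sub>\<le>\<^sub>0"
proof
  assume "z \<in> \<int>\<^sub>\<le>\<^sub>0"
  then obtain n where "z = of_int n" "n \<le> 0" by (auto elim!: nonpos_Ints_cases)
  thus False using assms by simp
qed

text \<open>For \<open>Re s0 < 0\<close> the reflected point has real part above 1, and there all
  Gamma arguments have positive real part. Continuity of the reflected side allows the functional
  equation, known only off a sparse set, to be used in the limit at \<open>s0\<close>.\<close>

lemma functional_equation_isCont:
  assumes K: "\<And>j. j \<in> {1..K} \<Longrightarrow> lam j > 0 \<and> Re (\<nu> j) \<ge> 0" and Q: "Q > 0"
    and cont: "isCont L (1 - cnj s0)" and s0: "Re s0 < 0"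
  shows "isCont (\<lambda>s. \<omega> * cnj (completed_L K Q lam \<nu> L (1 - cnj s))) s0"
proof -
  have "isCont (completed_L K Q lam \<nu> L) (1 - cnj s0)"
    unfolding completed_L_def
  proof (intro continuous_intros cont)
    fix j assume j: "j \<in> {1..K}"
    have "0 < lam j * Re (1 - cnj s0)" using K[OF j] s0 by (intro mult_pos_pos) auto
    hence "Re (of_real (lam j) * (1 - cnj s0) + \<nu> j) > 0" using K[OF j] by simp
    thus "of_real (lam j) * (1 - cnj s0) + \<nu> j \<notin> \<int>\<^sub>\<le>\<^sub>0"
      by (rule Re_pos_not_nonpos_Ints)
  qed (use Q in auto)
  moreover have "isCont (\<lambda>s. 1 - cnj s) s0" by (intro continuous_intros)
  ultimately have "isCont (\<lambda>s. completed_L K Q lam \<nu> L (1 - cnj s)) s0"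
    by (rule isCont_o2[rotated])
  thus ?thesis by (intro continuous_intros)
qed

text \<open>At \<open>s0\<close> the first Gamma factor has its argument at \<open>- n\<close>, a
  pole, while the reflected side stays finite. Multiplication by the entire functions
  \<open>rGamma\<close> turns the pole into a zero, and \<open>L s0\<close> is computed as a limit
  from the punctured neighbourhood where the equation holds. \<open>n \<ge> 1\<close> keeps
  \<open>Re s0 < 0\<close> even if \<open>Re (\<nu> 1) = 0\<close>.\<close>

lemma trivial_zero:
  fixes n :: nat
  assumes fe: "functional_equation K Q lam \<nu> \<omega> L" and K: "K \<ge> 1" and n: "n \<ge> 1"
    and cont: "\<And>s. s \<noteq> 1 \<Longrightarrow> isCont L s"
  defines "s0 \<equiv> - (of_nat n + \<nu> 1) / of_real (lam 1)"
  shows "L s0 = 0" and "Re s0 < 0"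
proof -
  have pos: "lam j > 0 \<and> Re (\<nu> j) \<ge> 0" if "j \<in> {1..K}" for j
    using fe that unfolding functional_equation_def by blast
  have Q: "Q > 0" using fe unfolding functional_equation_def by blast
  have l1: "lam 1 > 0" "Re (\<nu> 1) \<ge> 0" using pos[of 1] K by auto
  show s0: "Re s0 < 0" using l1 n unfolding s0_def by (simp add: Re_divide_of_real divide_neg_pos)
  define R where "R = (\<lambda>s. \<omega> * cnj (completed_L K Q lam \<nu> L (1 - cnj s)))"
  have "1 - cnj s0 \<noteq> 1" using s0 by auto
  hence "isCont R s0"
    unfolding R_def by (intro functional_equation_isCont pos Q cont s0)
  have "eventually (\<lambda>s. completed_L K Q lam \<nu> L s = R s) (at s0)"
    using fe unfolding functional_equation_def R_def
    by (auto intro: eventually_cosparse_imp_eventually_at)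
  \<comment> \<open>\<open>Gamma\<close> has the value 0 at its poles, so its product with
    \<open>rGamma\<close> is 1 only where \<open>rGamma\<close> is nonzero.\<close>
  moreover have "eventually (\<lambda>s. \<forall>j\<in>{1..K}. rGamma (of_real (lam j) * s + \<nu> j) \<noteq> 0) (at s0)"
  proof (subst eventually_ball_finite_distrib, simp, intro ballI)
    fix j assume j: "j \<in> {1..K}"
    show "eventually (\<lambda>s. rGamma (of_real (lam j) * s + \<nu> j) \<noteq> 0) (at s0)"
    proof (rule entire_eventually_nonzero[where w = 1])
      show "(\<lambda>s. rGamma (of_real (lam j) * s + \<nu> j)) holomorphic_on UNIV"
        by (intro holomorphic_intros)
      have "Re (of_real (lam j) * 1 + \<nu> j) > 0" using pos[OF j] by simp
      hence "of_real (lam j) * 1 + \<nu> j \<notin> \<int>\<^sub>\<le>\<^sub>0" by (rule Re_pos_not_nonpos_Ints)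
      thus "rGamma (of_real (lam j) * 1 + \<nu> j) \<noteq> 0" by (simp add: rGamma_eq_zero_iff)
    qed
  qed
  ultimately have "eventually (\<lambda>s. of_real Q powr (- s) * R s * (\<Prod>j=1..K. rGamma (of_real (lam j) * s + \<nu> j)) = L s) (at s0)"
  proof eventually_elim
    case (elim s)
    have "(\<Prod>j=1..K. Gamma (of_real (lam j) * s + \<nu> j)) * (\<Prod>j=1..K. rGamma (of_real (lam j) * s + \<nu> j)) = 1"
      unfolding prod.distrib[symmetric] using elim(2)
      by (intro prod.neutral) (auto simp: rGamma_inverse_Gamma)
    moreover have "of_real Q powr s * of_real Q powr (- s) = (1 :: complex)"
      using Q by (simp add: powr_minus)
    ultimately show ?case unfolding elim(1)[symmetric] completed_L_def
      by (metis (no_types, lifting) mult.assoc mult.commute mult.right_neutral)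
  qed
  moreover have "((\<lambda>s. of_real Q powr (- s) * R s * (\<Prod>j=1..K. rGamma (of_real (lam j) * s + \<nu> j))) \<longlongrightarrow>
     of_real Q powr (- s0) * R s0 * (\<Prod>j=1..K. rGamma (of_real (lam j) * s0 + \<nu> j))) (at s0)"
  proof -
    have "isCont (\<lambda>s. of_real Q powr (- s) * R s * (\<Prod>j=1..K. rGamma (of_real (lam j) * s + \<nu> j))) s0"
      using Q by (intro continuous_intros \<open>isCont R s0\<close>) auto
    thus ?thesis by (simp add: isCont_def)
  qed
  ultimately have "(L \<longlongrightarrow> of_real Q powr (- s0) * R s0 * (\<Prod>j=1..K. rGamma (of_real (lam j) * s0 + \<nu> j))) (at s0)"
    by (rule Lim_transform_eventually[rotated])
  moreover have "s0 \<noteq> 1" using s0 by auto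
  hence "(L \<longlongrightarrow> L s0) (at s0)" using cont[of s0] by (simp add: isCont_def)
  ultimately have "L s0 = of_real Q powr (- s0) * R s0 * (\<Prod>j=1..K. rGamma (of_real (lam j) * s0 + \<nu> j))"
    by (intro tendsto_unique[of "at s0"]) auto
  moreover have "(\<Prod>j=1..K. rGamma (of_real (lam j) * s0 + \<nu> j)) = 0"
  proof (rule prod_zero)
    have "of_real (lam 1) * s0 + \<nu> 1 = - of_nat n" using l1 by (simp add: s0_def)
    thus "\<exists>j\<in>{1..K}. rGamma (of_real (lam j) * s0 + \<nu> j) = 0"
      using K by (intro bexI[of _ 1]) (auto simp: rGamma_eq_zero_iff)
  qed auto
  ultimately show "L s0 = 0" by simp
qed

section \<open>The extended Selberg class\<close>

text \<open>Agreement near \<open>s0\<close> transfers both having a pole and having a given limit,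
  and these determine the value at \<open>s0\<close>. Identities between L-functions are first
  obtained only away from 1, and this closes the gap.\<close>

lemma nicely_meromorphic_eq:
  assumes nice: "L1 nicely_meromorphic_on UNIV" "L2 nicely_meromorphic_on UNIV"
    and eq: "\<And>s. s \<noteq> s0 \<Longrightarrow> L1 s = L2 s"
  shows "L1 = L2"
proof
  fix s
  show "L1 s = L2 s"
  proof (cases "s = s0")
    case True
    have ev: "eventually (\<lambda>w. L1 w = L2 w) (at s0)"
      using eq by (auto simp: eventually_at_filter)
    have pole: "is_pole L1 s0 \<longleftrightarrow> is_pole L2 s0"
      unfolding is_pole_def by (rule filterlim_cong) (use ev in auto)
    have lim: "(L1 \<longlongrightarrow> x) (at s0) \<longleftrightarrow> (L2 \<longlongrightarrow> x) (at s0)" for x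
      by (rule filterlim_cong) (use ev in auto)
    have n1: "(is_pole L1 s0 \<and> L1 s0 = 0) \<or> (L1 \<longlongrightarrow> L1 s0) (at s0)"
      and n2: "(is_pole L2 s0 \<and> L2 s0 = 0) \<or> (L2 \<longlongrightarrow> L2 s0) (at s0)"
      using nice by (auto simp: nicely_meromorphic_on_def)
    have excl: "\<not> (is_pole L1 s0 \<and> (L1 \<longlongrightarrow> x) (at s0))" for x
      using not_tendsto_and_filterlim_at_infinity[of "at s0" L1 x] by (auto simp: is_pole_def)
    have "L1 s0 = L2 s0"
    proof (cases "is_pole L1 s0")
      case True
      hence "L1 s0 = 0" using n1 excl[of "L1 s0"] by blast
      moreover have "L2 s0 = 0" using n2 True pole lim[of "L2 s0"] excl[of "L2 s0"] by blast
      ultimately show ?thesis by simp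
    next
      case False
      hence "(L2 \<longlongrightarrow> L1 s0) (at s0)" using n1 lim[of "L1 s0"] by blast
      moreover have "(L2 \<longlongrightarrow> L2 s0) (at s0)" using n2 False pole by blast
      ultimately show ?thesis by (intro tendsto_unique[of "at s0" L2]) auto
    qed
    thus ?thesis using True by simp
  qed (use eq in simp)
qed

lemma fin_order_of_entire_of_finite_order:
  assumes "entire_of_finite_order f"
  shows "f holomorphic_on UNIV" and "fin_order f"
proof -
  show hol: "f holomorphic_on UNIV" using assms by (simp add: entire_of_finite_order_def)
  obtain A :: real where "(\<lambda>s. norm (f s)) \<in> O[at_infinity](\<lambda>s. exp (norm s powr A))"
    using assms by (auto simp: entire_of_finite_order_def)
  then obtain c where c: "c > 0" "eventually (\<lambda>s. norm (norm (f s)) \<le> c * norm (exp (norm s powr A))) at_infinity"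
    by (elim landau_o.bigE)
  then obtain b where b: "\<And>s. norm s \<ge> b \<Longrightarrow> norm (f s) \<le> c * exp (norm s powr A)"
    by (auto simp: eventually_at_infinity)
  have "compact (f ` cball 0 (max b 1))"
    using holomorphic_on_imp_continuous_on[OF holomorphic_on_subset[OF hol]]
    by (intro compact_continuous_image) auto
  hence "bounded (f ` cball 0 (max b 1))" by (rule compact_imp_bounded)
  hence "\<exists>M. \<forall>x\<in>f ` cball 0 (max b 1). norm x \<le> M" by (simp only: bounded_iff)
  then obtain M where M': "\<forall>x\<in>f ` cball 0 (max b 1). norm x \<le> M" ..
  have M: "norm (f s) \<le> M" if "norm s \<le> max b 1" for s
  proof -
    have "f s \<in> f ` cball 0 (max b 1)" using that by (intro imageI) simp
    thus ?thesis using M' by blast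
  qed
  define n where "n = nat \<lceil>\<bar>A\<bar>\<rceil>"
  have n: "A \<le> real n" unfolding n_def by linarith
  define B where "B = \<bar>ln c\<bar> + \<bar>ln (max M 1)\<bar> + 1"
  have "norm (f s) \<le> exp (B * (1 + norm s) ^ n)" for s
  proof -
    define x where "x = (1 + norm s) ^ n"
    have x: "x \<ge> 1" unfolding x_def by (intro one_le_power) auto
    show ?thesis
    proof (cases "norm s \<le> max b 1")
      case True
      hence "norm (f s) \<le> max M 1" using M by (simp add: le_max_iff_disj)
      also have "\<dots> = exp (ln (max M 1))" by simp
      also have "ln (max M 1) \<le> B * 1" by (simp add: B_def)
      also have "B * 1 \<le> B * x" using x by (intro mult_left_mono) (auto simp: B_def)
      finally show ?thesis by (simp add: x_def)
    next
      case False
      hence s: "norm s \<ge> b" "norm s > 1" by auto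
      have "norm s powr A \<le> norm s powr real n" using n s by (intro powr_mono) auto
      also have "\<dots> = norm s ^ n" using s by (intro powr_realpow) linarith
      also have "\<dots> \<le> x" unfolding x_def by (intro power_mono) auto
      finally have px: "norm s powr A \<le> x" .
      have "norm (f s) \<le> c * exp (norm s powr A)" by (rule b[OF s(1)])
      also have "\<dots> = exp (ln c + norm s powr A)" using c(1) by (simp add: exp_add)
      also have "ln c + norm s powr A \<le> \<bar>ln c\<bar> * 1 + 1 * x" using px by simp
      also have "\<dots> \<le> \<bar>ln c\<bar> * x + 1 * x" using x by (intro add_mono mult_left_mono) auto
      also have "\<dots> \<le> B * x" using x by (simp add: B_def algebra_simps)
      finally show ?thesis by (simp add: x_def)
    qed
  qed
  thus "fin_order f" unfolding fin_order_def by blast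
qed

lemma fin_order_shift:
  assumes "fin_order f"
  shows "fin_order (\<lambda>z. f (p + z))"
proof -
  obtain B n where B: "B > 0" "\<And>z m. m \<ge> n \<Longrightarrow> norm (f z) \<le> exp (B * (1 + norm z) ^ m)"
    by (rule fin_orderE[OF assms]) (rule that)
  have "norm (f (p + z)) \<le> exp ((B * (1 + norm p) ^ n) * (1 + norm z) ^ n)" for z
  proof -
    have "1 + norm (p + z) \<le> (1 + norm p) * (1 + norm z)"
    proof -
      have "0 \<le> norm p * norm z" by simp
      thus ?thesis using norm_triangle_ineq[of p z] unfolding distrib_left distrib_right by linarith
    qed
    hence "(1 + norm (p + z)) ^ n \<le> ((1 + norm p) * (1 + norm z)) ^ n" by (intro power_mono) auto
    hence "B * (1 + norm (p + z)) ^ n \<le> (B * (1 + norm p) ^ n) * (1 + norm z) ^ n"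
      using B(1) by (simp add: power_mult_distrib mult.assoc)
    thus ?thesis using B(2)[of n "p + z"] by (meson exp_le_cancel_iff order_refl order_trans)
  qed
  thus ?thesis unfolding fin_order_def by blast
qed

lemma ext_selberg_class_entire:
  assumes "L \<in> ext_selberg_class"
  obtains k f where "f holomorphic_on UNIV" "fin_order f" "\<And>s. s \<noteq> 1 \<Longrightarrow> f s = (s - 1) ^ k * L s"
  using assms fin_order_of_entire_of_finite_order unfolding ext_selberg_class_def by blast

lemma ext_selberg_class_holomorphic:
  assumes "L \<in> ext_selberg_class"
  shows "L holomorphic_on - {1}"
proof -
  obtain k f where f: "f holomorphic_on UNIV" "\<And>s. s \<noteq> 1 \<Longrightarrow> f s = (s - 1) ^ k * L s"
    using ext_selberg_class_entire[OF assms] by metis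
  have "(\<lambda>s. f s / (s - 1) ^ k) holomorphic_on - {1}"
    by (intro holomorphic_intros holomorphic_on_subset[OF f(1)]) auto
  thus ?thesis by (rule holomorphic_transform) (use f(2) in auto)
qed

lemma ext_selberg_class_isCont:
  assumes "L \<in> ext_selberg_class" "s \<noteq> 1"
  shows "isCont L s"
  using holomorphic_on_imp_continuous_on[OF ext_selberg_class_holomorphic[OF assms(1)]] assms(2)
  by (auto simp: continuous_on_eq_continuous_at open_Compl)

text \<open>The identity is continued for the entire function
  \<open>f s - \<alpha> * (s - 1) ^ k\<close>, which avoids a possible pole of \<open>L\<close>. It
  ensures that a non-constant \<open>L\<close> has a Dirichlet coefficient deviating from those of
  the constant \<alpha>.\<close>

lemma ext_selberg_class_constant:
  assumes L: "L \<in> ext_selberg_class" and eq: "\<And>s. Re s > 1 \<Longrightarrow> L s = \<alpha>"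
  shows "L constant_on UNIV"
proof -
  obtain k f where f: "f holomorphic_on UNIV" "\<And>s. s \<noteq> 1 \<Longrightarrow> f s = (s - 1) ^ k * L s"
    using ext_selberg_class_entire[OF L] by metis
  define g where "g = (\<lambda>s. f s - \<alpha> * (s - 1) ^ k)"
  have "g s = 0" for s
  proof (rule analytic_continuation_open[of "{s. Re s > 1}" UNIV g "\<lambda>_. 0"])
    have "2 \<in> {s. Re s > 1}" by simp
    thus "{s. Re s > 1} \<noteq> {}" by blast
    show "g holomorphic_on UNIV" unfolding g_def by (intro holomorphic_intros f)
    show "g z = 0" if "z \<in> {s. Re s > 1}" for z
    proof -
      have "Re z > 1" using that by simp
      hence "z \<noteq> 1" by auto
      thus ?thesis using f(2)[of z] eq[OF \<open>Re z > 1\<close>] by (simp add: g_def)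
    qed
  qed (auto intro: open_halfspace_Re_gt)
  hence "L s = \<alpha>" if "s \<noteq> 1" for s
    using that f(2)[OF that] by (simp add: g_def)
  moreover have "L nicely_meromorphic_on UNIV" using L by (simp add: ext_selberg_class_def)
  ultimately have "L = (\<lambda>_. \<alpha>)"
    using nicely_meromorphic_eq[of L "\<lambda>_. \<alpha>" 1] by blast
  thus ?thesis by (simp add: constant_on_def)
qed

text \<open>\<open>N\<close> is the first index at which the coefficients deviate from those of the
  constant \<alpha>. The exponential factor is \<open>N\<close> to the power \<open>s\<close> and
  normalises the leading term to \<open>c\<close>; the rate \<open>\<delta>\<close> is the gap from
  \<open>ln N\<close> to the next possible frequency \<open>ln (N + 1)\<close>.\<close>

lemma leading_term:
  assumes L: "L \<in> ext_selberg_class" and nconst: "\<not> L constant_on UNIV"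
    and exp: "dirichlet_expansion a L"
  obtains N c \<delta> B where "N \<ge> (1::nat)" "c \<noteq> 0" "\<delta> > 0" "B > 0"
    "\<And>s. Re s \<ge> 2 \<Longrightarrow> norm (exp (of_real (ln (real N)) * s) * (L s - \<alpha>) - c) \<le> B * exp (- \<delta> * Re s)"
    "a 1 \<noteq> \<alpha> \<Longrightarrow> N = 1 \<and> c = a 1 - \<alpha>"
proof -
  have ex: "\<exists>n\<ge>1. a n \<noteq> (if n = 1 then \<alpha> else 0)"
  proof (rule ccontr)
    assume "\<not> ?thesis"
    hence a: "a n = (if n = 1 then \<alpha> else 0)" if "n \<ge> 1" for n using that by blast
    have "L s = \<alpha>" if "Re s > 1" for s
    proof -
      have "(\<lambda>n. a (Suc n) * of_nat (Suc n) powr (- s)) sums L s"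
        using exp that unfolding dirichlet_expansion_def by blast
      moreover have "(\<lambda>n. a (Suc n) * of_nat (Suc n) powr (- s)) = (\<lambda>n. if n = 0 then \<alpha> else 0)"
        by (auto simp: a fun_eq_iff)
      moreover have "(\<lambda>n. if n = (0::nat) then \<alpha> else 0) sums \<alpha>" using sums_single[of 0 "\<lambda>_. \<alpha>"] by simp
      ultimately show ?thesis using sums_unique2 by metis
    qed
    thus False using ext_selberg_class_constant[OF L] nconst by blast
  qed
  define N where "N = (LEAST n. n \<ge> 1 \<and> a n \<noteq> (if n = 1 then \<alpha> else 0))"
  have N: "N \<ge> 1" "a N \<noteq> (if N = 1 then \<alpha> else 0)"
    using LeastI_ex[OF ex[unfolded Bex_def]] unfolding N_def by auto
  have zero: "a n = (if n = 1 then \<alpha> else 0)" if "1 \<le> n" "n < N" for n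
    using that not_less_Least[of n "\<lambda>n. n \<ge> 1 \<and> a n \<noteq> (if n = 1 then \<alpha> else 0)"] unfolding N_def by blast
  define c where "c = a N - (if N = 1 then \<alpha> else 0)"
  have c: "c \<noteq> 0" using N by (simp add: c_def)
  obtain B where B: "B > 0" "\<And>s. Re s \<ge> 2 \<Longrightarrow> norm (L s - \<alpha> - c * of_nat N powr (- s)) \<le> B * real (N + 1) powr (- Re s)"
    using dirichlet_asymptotic[OF exp N(1) zero] unfolding c_def by metis
  define \<delta> where "\<delta> = ln (real (N + 1)) - ln (real N)"
  have \<delta>: "\<delta> > 0" using N by (simp add: \<delta>_def)
  show ?thesis
  proof (rule that[OF N(1) c \<delta> B(1)])
    fix s assume s: "Re s \<ge> 2"
    have "exp (of_real (ln (real N)) * s) * of_nat N powr (- s) = 1"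
      using N by (simp add: powr_def Ln_of_nat exp_add[symmetric] mult.commute)
    hence "exp (of_real (ln (real N)) * s) * (L s - \<alpha>) - c =
        exp (of_real (ln (real N)) * s) * (L s - \<alpha> - c * of_nat N powr (- s))"
      by (simp add: right_diff_distrib mult.left_commute[of _ c])
    also have "norm \<dots> = exp (ln (real N) * Re s) * norm (L s - \<alpha> - c * of_nat N powr (- s))"
      by (simp add: norm_mult)
    also have "\<dots> \<le> exp (ln (real N) * Re s) * (B * real (N + 1) powr (- Re s))"
      using B(2)[OF s] by (intro mult_left_mono) auto
    also have "\<dots> = B * (exp (ln (real N) * Re s) * exp (- Re s * ln (real (N + 1))))"
      by (simp add: powr_def)
    also have "\<dots> = B * exp (- \<delta> * Re s)"
    proof -
      have "ln (real N) * Re s + - Re s * ln (real (N + 1)) = - \<delta> * Re s"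
        by (simp add: \<delta>_def algebra_simps)
      thus ?thesis by (simp only: exp_add[symmetric])
    qed
    finally show "norm (exp (of_real (ln (real N)) * s) * (L s - \<alpha>) - c) \<le> B * exp (- \<delta> * Re s)" .
  next
    assume "a 1 \<noteq> \<alpha>"
    hence "N \<le> 1" unfolding N_def by (intro Least_le) auto
    thus "N = 1 \<and> c = a 1 - \<alpha>" using N by (simp add: c_def)
  qed
qed

text \<open>Outside radius \<open>2 * norm p\<close> the distance to \<open>p\<close> is at least
  half the modulus, and only finitely many points of \<open>G\<close> lie within any disc. The point
  1 is adjoined without a bound on \<open>\<mu>'\<close>, because there the order of a function
  cleared of its pole need not be the value multiplicity.\<close>

lemma shifted_summable:
  fixes \<mu> \<mu>' :: "complex \<Rightarrow> nat"
  assumes sum: "(\<lambda>s. real (\<mu> s) / norm s) summable_on {s\<in>G. norm s \<ge> r0}"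
    and fin: "\<And>r. finite (G \<inter> cball 0 r)"
    and le: "\<And>s. s \<in> G \<Longrightarrow> s \<noteq> 1 \<Longrightarrow> \<mu>' s \<le> \<mu> s"
  shows "(\<lambda>z. real (\<mu>' (p + z)) / norm z) summable_on {z. p + z \<in> insert 1 G}"
proof -
  define T where "T = max (max (2 * norm p) r0) 1"
  define S where "S = {s\<in>G. norm s > T}"
  have "(\<lambda>s. real (\<mu> s) / norm s) summable_on S"
    by (rule summable_on_subset_banach[OF sum]) (auto simp: S_def T_def)
  hence "(\<lambda>s. 2 * (real (\<mu> s) / norm s)) summable_on S" by (rule summable_on_cmult_right)
  hence 1: "(\<lambda>s. real (\<mu>' s) / norm (s - p)) summable_on S"
  proof (rule summable_on_comparison_test)
    fix s assume s: "s \<in> S"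
    hence s': "s \<in> G" "s \<noteq> 1" "norm s > 2 * norm p" "norm s > 0" by (auto simp: S_def T_def)
    have "norm s / 2 \<le> norm (s - p)" using norm_triangle_ineq2[of s p] s'(3) by linarith
    hence "real (\<mu>' s) / norm (s - p) \<le> real (\<mu> s) / (norm s / 2)"
      using le[OF s'(1,2)] s'(4) by (intro frac_le) auto
    thus "real (\<mu>' s) / norm (s - p) \<le> 2 * (real (\<mu> s) / norm s)" by (simp add: mult.commute)
  qed auto
  have "finite (insert 1 (G \<inter> cball 0 T))" using fin by simp
  hence "(\<lambda>s. real (\<mu>' s) / norm (s - p)) summable_on insert 1 (G \<inter> cball 0 T)"
    by (rule summable_on_finite)
  from summable_on_union[OF this 1]
  have "(\<lambda>s. real (\<mu>' s) / norm (s - p)) summable_on (insert 1 (G \<inter> cball 0 T) \<union> S)" .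
  also have "insert 1 (G \<inter> cball 0 T) \<union> S = insert 1 G" by (auto simp: S_def)
  also have "insert 1 G = (\<lambda>z. p + z) ` {z. p + z \<in> insert 1 G}"
    by (auto simp: image_iff) (metis add.commute diff_add_cancel)+
  finally have "((\<lambda>s. real (\<mu>' s) / norm (s - p)) \<circ> (\<lambda>z. p + z)) summable_on {z. p + z \<in> insert 1 G}"
    by (subst (asm) summable_on_reindex) auto
  thus ?thesis by (simp add: o_def)
qed

lemma zorder_exp_shift:
  assumes "f holomorphic_on UNIV" "f w \<noteq> 0"
  shows "zorder (\<lambda>z. exp (b * (p + z)) * f (p + z)) z = zorder f (p + z)"
proof -
  have hol: "(\<lambda>z. f (p + z)) holomorphic_on UNIV"
  proof -
    have "(\<lambda>z. p + z) holomorphic_on UNIV" by (intro holomorphic_intros)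
    from holomorphic_on_compose_gen[OF this assms(1)] show ?thesis by (simp add: o_def)
  qed
  have "zorder (\<lambda>z. exp (b * (p + z)) * f (p + z)) z = zorder (\<lambda>z. exp (b * (p + z))) z + zorder (\<lambda>z. f (p + z)) z"
    by (rule zorder_mult_entire[of _ _ "w - p"]) (use hol assms in \<open>auto intro!: holomorphic_intros\<close>)
  also have "zorder (\<lambda>z. exp (b * (p + z))) z = 0"
    by (rule zorder_eq_0I) (auto intro!: analytic_intros)
  also have "zorder (\<lambda>z. f (p + z)) z = zorder (\<lambda>u. f (p + (u + z))) 0"
    by (rule zorder_shift)
  also have "\<dots> = zorder f (p + z)"
    by (subst zorder_shift[of f]) (simp add: add_ac)
  finally show ?thesis by simp
qed

text \<open>Away from 1 the factor \<open>(s - 1) ^ k\<close> that clears the pole has order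
  0.\<close>

lemma value_mult_eq_zorder:
  assumes L: "L \<in> ext_selberg_class" and s: "s \<noteq> 1"
    and f: "f holomorphic_on UNIV" "f w \<noteq> 0" "\<And>s. s \<noteq> 1 \<Longrightarrow> f s = (s - 1) ^ k * (L s - \<alpha>)"
  shows "zorder (\<lambda>w. L w - \<alpha>) s = zorder f s"
proof -
  have "eventually (\<lambda>w. w \<in> - {1}) (at s)" using s by (intro eventually_at_in_open') auto
  hence ev: "eventually (\<lambda>w. f w = (w - 1) ^ k * (L w - \<alpha>)) (at s)"
    by eventually_elim (use f(3) in auto)
  have "zorder f s = zorder (\<lambda>w. (w - 1) ^ k * (L w - \<alpha>)) s"
    by (rule zorder_cong) (use ev in auto)
  also have "\<dots> = zorder (\<lambda>w. (w - 1) ^ k) s + zorder (\<lambda>w. L w - \<alpha>) s"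
  proof (rule zorder_times_analytic)
    show "(\<lambda>w. (w - 1) ^ k) analytic_on {s}" by (intro analytic_intros)
    have "L analytic_on {s}"
      using ext_selberg_class_holomorphic[OF L] s by (auto simp: analytic_at open_Compl intro!: exI[of _ "- {1}"])
    thus "(\<lambda>w. L w - \<alpha>) analytic_on {s}" by (intro analytic_intros)
    show "eventually (\<lambda>w. (w - 1) ^ k * (L w - \<alpha>) \<noteq> 0) (at s)"
      using ev entire_eventually_nonzero[OF f(1,2), of s] by eventually_elim simp
  qed
  also have "zorder (\<lambda>w. (w - 1) ^ k) s = 0"
    by (rule zorder_eq_0I) (use s in \<open>auto intro!: analytic_intros\<close>)
  finally show ?thesis by simp
qed

lemma entire_finite_zeros_cball:
  assumes "f holomorphic_on UNIV" "f w \<noteq> 0"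
  shows "finite {z \<in> cball 0 r. f z = 0}"
proof (cases "f constant_on UNIV")
  case True
  hence "f z \<noteq> 0" for z using assms(2) by (metis UNIV_I constant_on_def)
  thus ?thesis by simp
next
  case False
  thus ?thesis by (intro holomorphic_compact_finite_zeros[OF assms(1)]) auto
qed

text \<open>The constants stem from the leading terms: \<open>q = c1 / c2\<close> and
  \<open>b = ln N2 - ln N1\<close>. Clearing the pole, absorbing the exponential normalisation and
  moving the origin far to the right bring the two functions into the form required by
  \<open>entire_ratio_constant\<close>.\<close>

lemma shared_value_relation:
  assumes L1: "L1 \<in> ext_selberg_class" and L2: "L2 \<in> ext_selberg_class"
    and nc1: "\<not> L1 constant_on UNIV" and nc2: "\<not> L2 constant_on UNIV"
    and d1: "dirichlet_expansion a1 L1" and d2: "dirichlet_expansion a2 L2"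
    and share: "share_CM_except L1 L2 \<alpha> G"
    and conv: "order_one_convergence_type L1 L2 \<alpha> G"
  obtains q :: complex and b :: real where "q \<noteq> 0"
    "\<And>s. s \<noteq> 1 \<Longrightarrow> L1 s - \<alpha> = q * exp (of_real b * s) * (L2 s - \<alpha>)"
    "a1 1 \<noteq> \<alpha> \<Longrightarrow> a2 1 \<noteq> \<alpha> \<Longrightarrow> b = 0 \<and> q = (a1 1 - \<alpha>) / (a2 1 - \<alpha>)"
proof -
  obtain k1 h1 where h1: "h1 holomorphic_on UNIV" "fin_order h1" "\<And>s. s \<noteq> 1 \<Longrightarrow> h1 s = (s - 1) ^ k1 * L1 s"
    by (rule ext_selberg_class_entire[OF L1]) (rule that)
  obtain k2 h2 where h2: "h2 holomorphic_on UNIV" "fin_order h2" "\<And>s. s \<noteq> 1 \<Longrightarrow> h2 s = (s - 1) ^ k2 * L2 s"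
    by (rule ext_selberg_class_entire[OF L2]) (rule that)
  \<comment> \<open>One exponent for both functions, so that the powers of \<open>s - 1\<close>
    cancel in the quotient.\<close>
  define k where "k = k1 + k2"
  define f1 where "f1 = (\<lambda>s. h1 s * (s - 1) ^ k2 - \<alpha> * (s - 1) ^ k)"
  define f2 where "f2 = (\<lambda>s. h2 s * (s - 1) ^ k1 - \<alpha> * (s - 1) ^ k)"
  have lin: "fin_order (\<lambda>s. s - 1)" using fin_order_linear[of "- 1" 1] by simp
  have hol1: "f1 holomorphic_on UNIV" unfolding f1_def by (intro holomorphic_intros h1)
  have hol2: "f2 holomorphic_on UNIV" unfolding f2_def by (intro holomorphic_intros h2)
  have fin1: "fin_order f1" unfolding f1_def
    by (intro fin_order_diff fin_order_mult fin_order_power fin_order_const lin h1)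
  have fin2: "fin_order f2" unfolding f2_def
    by (intro fin_order_diff fin_order_mult fin_order_power fin_order_const lin h2)
  have f1: "f1 s = (s - 1) ^ k * (L1 s - \<alpha>)" if "s \<noteq> 1" for s
    using h1(3)[OF that] by (simp add: f1_def k_def power_add algebra_simps)
  have f2: "f2 s = (s - 1) ^ k * (L2 s - \<alpha>)" if "s \<noteq> 1" for s
    using h2(3)[OF that] by (simp add: f2_def k_def power_add algebra_simps)
  obtain N1 c1 \<delta>1 B1 where lead1: "N1 \<ge> (1::nat)" "c1 \<noteq> 0" "\<delta>1 > 0" "B1 > 0"
    "\<And>s. Re s \<ge> 2 \<Longrightarrow> norm (exp (of_real (ln (real N1)) * s) * (L1 s - \<alpha>) - c1) \<le> B1 * exp (- \<delta>1 * Re s)"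
    "a1 1 \<noteq> \<alpha> \<Longrightarrow> N1 = 1 \<and> c1 = a1 1 - \<alpha>"
    by (rule leading_term[OF L1 nc1 d1]) (rule that)
  obtain N2 c2 \<delta>2 B2 where lead2: "N2 \<ge> (1::nat)" "c2 \<noteq> 0" "\<delta>2 > 0" "B2 > 0"
    "\<And>s. Re s \<ge> 2 \<Longrightarrow> norm (exp (of_real (ln (real N2)) * s) * (L2 s - \<alpha>) - c2) \<le> B2 * exp (- \<delta>2 * Re s)"
    "a2 1 \<noteq> \<alpha> \<Longrightarrow> N2 = 1 \<and> c2 = a2 1 - \<alpha>"
    by (rule leading_term[OF L2 nc2 d2]) (rule that)
  define \<delta> where "\<delta> = min \<delta>1 \<delta>2"
  have \<delta>: "\<delta> > 0" using lead1 lead2 by (simp add: \<delta>_def)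
  have decay: "B * exp (- \<delta>' * x) \<le> B * exp (- \<delta> * x)" if "B > 0" "\<delta> \<le> \<delta>'" "x \<ge> 0" for B \<delta>' x
    using that by (simp add: mult_right_mono)
  have small: "eventually (\<lambda>x. B * exp (- \<delta> * x) < e) at_top" if "e > 0" for B e
  proof -
    have "((\<lambda>x. B * exp (- \<delta> * x)) \<longlongrightarrow> 0) at_top" using \<delta> by real_asymp
    thus ?thesis using that by (rule order_tendstoD(2))
  qed
  \<comment> \<open>Beyond \<open>p\<close> both errors stay below half of the leading constant, so
    neither function vanishes for \<open>Re s \<ge> p\<close>; \<open>p \<ge> 2\<close> is the range
    of \<open>leading_term\<close> and keeps 1 out of this half plane.\<close>
  have "eventually (\<lambda>x. B1 * exp (- \<delta> * x) < norm c1 / 2 \<and> B2 * exp (- \<delta> * x) < norm c2 / 2 \<and> x \<ge> 2) at_top"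
    using lead1(2) lead2(2) by (intro eventually_conj small eventually_ge_at_top) auto
  then obtain p :: real where p: "B1 * exp (- \<delta> * p) < norm c1 / 2" "B2 * exp (- \<delta> * p) < norm c2 / 2" "p \<ge> 2"
    by (auto dest: eventually_happens)
  define g1 where "g1 = (\<lambda>s. exp (of_real (ln (real N1)) * s) * (L1 s - \<alpha>))"
  define g2 where "g2 = (\<lambda>s. exp (of_real (ln (real N2)) * s) * (L2 s - \<alpha>))"
  have g1: "norm (g1 s - c1) \<le> B1 * exp (- \<delta> * Re s)" if "Re s \<ge> p" for s
    unfolding g1_def
    by (rule order_trans[OF lead1(5) decay[OF lead1(4)]]) (use that p(3) in \<open>auto simp: \<delta>_def\<close>)
  have g2: "norm (g2 s - c2) \<le> B2 * exp (- \<delta> * Re s)" if "Re s \<ge> p" for s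
    unfolding g2_def
    by (rule order_trans[OF lead2(5) decay[OF lead2(4)]]) (use that p(3) in \<open>auto simp: \<delta>_def\<close>)
  have low: "norm c / 2 \<le> norm g" if "norm (g - c) \<le> B * exp (- \<delta> * x)" "B > 0" "x \<ge> p"
    "B * exp (- \<delta> * p) < norm c / 2" for g c :: complex and B x
  proof -
    have "B * exp (- \<delta> * x) \<le> B * exp (- \<delta> * p)" using that(2,3) \<delta> by simp
    thus ?thesis using that(1,4) norm_triangle_ineq2[of c g] norm_minus_commute[of c g] by linarith
  qed
  have low1: "norm c1 / 2 \<le> norm (g1 s)" if "Re s \<ge> p" for s
    by (rule low[OF g1[OF that] lead1(4) that p(1)])
  have low2: "norm c2 / 2 \<le> norm (g2 s)" if "Re s \<ge> p" for s
    by (rule low[OF g2[OF that] lead2(4) that p(2)])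
  define P where "P = complex_of_real p"
  define \<phi> where "\<phi> = (\<lambda>z. exp (of_real (ln (real N1)) * (P + z)) * f1 (P + z))"
  define \<psi> where "\<psi> = (\<lambda>z. exp (of_real (ln (real N2)) * (P + z)) * f2 (P + z))"
  have shift: "\<phi> z = (P + z - 1) ^ k * g1 (P + z)" "\<psi> z = (P + z - 1) ^ k * g2 (P + z)" if "P + z \<noteq> 1" for z
    using f1[OF that] f2[OF that] by (simp_all add: \<phi>_def \<psi>_def g1_def g2_def)
  have ne1: "P + z \<noteq> 1" if "Re z \<ge> 0" for z
  proof
    assume "P + z = 1"
    hence "Re (P + z) = 1" by simp
    thus False using that p(3) by (simp add: P_def)
  qed
  have nz: "g1 (P + z) \<noteq> 0" "g2 (P + z) \<noteq> 0" if "Re z \<ge> 0" for z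
    using low1[of "P + z"] low2[of "P + z"] that lead1(2) lead2(2) by (auto simp: P_def)
  have nz': "\<phi> z \<noteq> 0" "\<psi> z \<noteq> 0" if "Re z \<ge> 0" for z
    using nz[OF that] ne1[OF that] shift[OF ne1[OF that]] by auto
  have f1P: "f1 P \<noteq> 0" and f2P: "f2 P \<noteq> 0"
    using nz'[of 0] by (auto simp: \<phi>_def \<psi>_def)
  have holP: "(\<lambda>z. f (P + z)) holomorphic_on UNIV" if "f holomorphic_on UNIV" for f :: "complex \<Rightarrow> complex"
  proof -
    have "(\<lambda>z. P + z) holomorphic_on UNIV" by (intro holomorphic_intros)
    from holomorphic_on_compose_gen[OF this that] show ?thesis by (simp add: o_def)
  qed
  have exp_fin: "fin_order (\<lambda>z. exp (of_real x * (P + z)))" for x :: real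
    using fin_order_exp_linear[of "of_real x * P" "of_real x"] by (simp add: distrib_left)
  define m1 where "m1 = (\<lambda>s. nat (zorder f1 s))"
  define m2 where "m2 = (\<lambda>s. nat (zorder f2 s))"
  have zo1: "zorder \<phi> z = zorder f1 (P + z)" for z
    unfolding \<phi>_def by (rule zorder_exp_shift[OF hol1 f1P])
  have zo2: "zorder \<psi> z = zorder f2 (P + z)" for z
    unfolding \<psi>_def by (rule zorder_exp_shift[OF hol2 f2P])
  have v1: "value_mult L1 \<alpha> s = m1 s" if "s \<noteq> 1" for s
    unfolding value_mult_def m1_def using value_mult_eq_zorder[OF L1 that hol1 f1P f1] by simp
  have v2: "value_mult L2 \<alpha> s = m2 s" if "s \<noteq> 1" for s
    unfolding value_mult_def m2_def using value_mult_eq_zorder[OF L2 that hol2 f2P f2] by simp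
  define \<mu> where "\<mu> = (\<lambda>s. max (value_mult L1 \<alpha> s) (value_mult L2 \<alpha> s))"
  have G_sub: "G \<subseteq> {s. value_mult L1 \<alpha> s > 0 \<or> value_mult L2 \<alpha> s > 0}"
    and share_eq: "s \<notin> G \<Longrightarrow> value_mult L1 \<alpha> s = value_mult L2 \<alpha> s" for s
    using share by (simp_all add: share_CM_except_def)
  have finG: "finite (G \<inter> cball 0 r)" for r
  proof (rule finite_subset)
    show "finite (insert 1 ({z \<in> cball 0 r. f1 z = 0} \<union> {z \<in> cball 0 r. f2 z = 0}))"
      using entire_finite_zeros_cball[OF hol1 f1P] entire_finite_zeros_cball[OF hol2 f2P] by simp
    show "G \<inter> cball 0 r \<subseteq> insert 1 ({z \<in> cball 0 r. f1 z = 0} \<union> {z \<in> cball 0 r. f2 z = 0})"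
    proof
      fix s assume s: "s \<in> G \<inter> cball 0 r"
      show "s \<in> insert 1 ({z \<in> cball 0 r. f1 z = 0} \<union> {z \<in> cball 0 r. f2 z = 0})"
      proof (cases "s = 1")
        case False
        have "value_mult L1 \<alpha> s > 0 \<or> value_mult L2 \<alpha> s > 0"
          using G_sub s by auto
        hence "zorder f1 s > 0 \<or> zorder f2 s > 0" using v1[OF False] v2[OF False] by (auto simp: m1_def m2_def)
        hence "f1 s = 0 \<or> f2 s = 0"
          using zorder_entire_pos_iff(1)[OF hol1 f1P, of s] zorder_entire_pos_iff(1)[OF hol2 f2P, of s] by simp
        thus ?thesis using s by auto
      qed auto
    qed
  qed
  have cnt: "counting L1 L2 \<alpha> G = (\<lambda>r. \<Sum>s\<in>G \<inter> cball 0 r. \<mu> s)"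
    by (simp add: counting_def \<mu>_def fun_eq_iff)
  obtain r0 where r0: "r0 > 0" "(\<lambda>r. real (\<Sum>s\<in>G \<inter> cball 0 r. \<mu> s) / r\<^sup>2) integrable_on {r0..}"
    using conv unfolding order_one_convergence_type_def cnt by (elim exE conjE) (rule that)
  have summ: "(\<lambda>s. real (\<mu> s) / norm s) summable_on {s\<in>G. norm s \<ge> r0}"
    by (rule counting_integral_summable[OF finG r0])
  define \<Gamma> where "\<Gamma> = {z. P + z \<in> insert 1 G}"
  have le1: "m1 s \<le> \<mu> s" and le2: "m2 s \<le> \<mu> s" if "s \<noteq> 1" for s
    using v1[OF that] v2[OF that] by (simp_all add: \<mu>_def)
  have sum1: "(\<lambda>g. real (nat (zorder \<phi> g)) / norm g) summable_on \<Gamma>"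
    using shifted_summable[OF summ finG le1, of P] by (simp add: zo1 \<Gamma>_def m1_def)
  have sum2: "(\<lambda>g. real (nat (zorder \<psi> g)) / norm g) summable_on \<Gamma>"
    using shifted_summable[OF summ finG le2, of P] by (simp add: zo2 \<Gamma>_def m2_def)
  have zo: "zorder \<phi> z = zorder \<psi> z" if "z \<notin> \<Gamma>" for z
  proof -
    have "P + z \<noteq> 1" "P + z \<notin> G" using that by (auto simp: \<Gamma>_def)
    hence "m1 (P + z) = m2 (P + z)"
      using share_eq[of "P + z"] v1[of "P + z"] v2[of "P + z"] by simp
    thus ?thesis
      using zorder_entire_pos_iff(2)[OF hol1 f1P, of "P + z"] zorder_entire_pos_iff(2)[OF hol2 f2P, of "P + z"]
      unfolding zo1 zo2 m1_def m2_def by simp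
  qed
  define q where "q = c1 / c2"
  have q: "q \<noteq> 0" using lead1(2) lead2(2) by (simp add: q_def)
  \<comment> \<open>The numerator comes from writing the difference of quotients over a common
    denominator, the denominator from \<open>norm c2 / 2 \<le> norm (g2 s)\<close>.\<close>
  define C where "C = (B1 * norm c2 + norm c1 * B2) / (norm c2 / 2 * norm c2)"
  have ratio: "norm (\<phi> z / \<psi> z - q) \<le> C * exp (- \<delta> * Re z)" if z: "Re z \<ge> 0" for z
  proof -
    define s where "s = P + z"
    have s: "Re s \<ge> p" "Re s \<ge> Re z" using z p(3) by (auto simp: s_def P_def)
    have "\<phi> z / \<psi> z = g1 s / g2 s"
      using shift[OF ne1[OF z]] ne1[OF z] by (simp add: s_def)
    also have "g1 s / g2 s - q = ((g1 s - c1) * c2 - c1 * (g2 s - c2)) / (g2 s * c2)"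
      using nz(2)[OF z] lead2(2) by (simp add: q_def s_def field_simps)
    finally have "norm (\<phi> z / \<psi> z - q) = norm ((g1 s - c1) * c2 - c1 * (g2 s - c2)) / (norm (g2 s) * norm c2)"
      by (simp add: norm_divide norm_mult)
    also have "\<dots> \<le> ((B1 * norm c2 + norm c1 * B2) * exp (- \<delta> * Re s)) / (norm c2 / 2 * norm c2)"
    proof (rule frac_le)
      have "norm ((g1 s - c1) * c2 - c1 * (g2 s - c2)) \<le> norm (g1 s - c1) * norm c2 + norm c1 * norm (g2 s - c2)"
        using norm_triangle_ineq4[of "(g1 s - c1) * c2" "c1 * (g2 s - c2)"] by (simp add: norm_mult)
      also have "\<dots> \<le> (B1 * exp (- \<delta> * Re s)) * norm c2 + norm c1 * (B2 * exp (- \<delta> * Re s))"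
        using g1[OF s(1)] g2[OF s(1)] by (intro add_mono mult_left_mono mult_right_mono) auto
      finally show "norm ((g1 s - c1) * c2 - c1 * (g2 s - c2)) \<le> (B1 * norm c2 + norm c1 * B2) * exp (- \<delta> * Re s)"
        by (simp add: algebra_simps)
      show "norm c2 / 2 * norm c2 \<le> norm (g2 s) * norm c2"
        using low2[OF s(1)] by (intro mult_right_mono) auto
    qed (use lead1 lead2 in auto)
    also have "\<dots> = C * exp (- \<delta> * Re s)" by (simp add: C_def)
    also have "\<dots> \<le> C * exp (- \<delta> * Re z)"
      using s(2) \<delta> lead1(4) lead2(4) by (intro mult_left_mono) (auto simp: C_def)
    finally show ?thesis .
  qed
  have key: "\<phi> z = q * \<psi> z" for z
  proof (rule entire_ratio_constant[of \<phi> \<psi> \<Gamma> q \<delta> C])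
    show "\<phi> holomorphic_on UNIV" "\<psi> holomorphic_on UNIV"
      unfolding \<phi>_def \<psi>_def by (intro holomorphic_intros holP hol1 hol2)+
    show "fin_order \<phi>" "fin_order \<psi>"
      unfolding \<phi>_def \<psi>_def
      by (intro fin_order_mult exp_fin fin_order_shift fin1 fin2)+
    show "\<phi> 0 \<noteq> 0" "\<psi> 0 \<noteq> 0" using nz'[of 0] by auto
  qed (use zo sum1 sum2 q \<delta> nz' ratio in auto)
  define b where "b = ln (real N2) - ln (real N1)"
  show ?thesis
  proof (rule that[OF q, of b])
    fix s :: complex assume s: "s \<noteq> 1"
    have "(s - 1) ^ k * g1 s = q * ((s - 1) ^ k * g2 s)"
      using key[of "s - P"] shift[of "s - P"] s by simp
    hence "g1 s = q * g2 s" using s by simp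
    hence "exp (of_real (ln (real N1)) * s) * (L1 s - \<alpha>) =
        exp (of_real (ln (real N1)) * s) * (q * exp (of_real b * s) * (L2 s - \<alpha>))"
      by (simp add: g1_def g2_def b_def left_diff_distrib exp_diff)
    thus "L1 s - \<alpha> = q * exp (of_real b * s) * (L2 s - \<alpha>)" by simp
  next
    assume "a1 1 \<noteq> \<alpha>" "a2 1 \<noteq> \<alpha>"
    thus "b = 0 \<and> q = (a1 1 - \<alpha>) / (a2 1 - \<alpha>)"
      using lead1(6) lead2(6) by (simp add: b_def q_def)
  qed
qed

text \<open>Without Gamma factors the completed function is \<open>L s * Q powr s\<close>, and
  \<open>Q powr s\<close> never vanishes; zeros are thus reflected in the line of real part 1/2.
  Continuity carries the equation, known near \<open>s0\<close>, to \<open>s0\<close>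
  itself.\<close>

lemma reflected_zero_degree_0:
  assumes fe: "functional_equation 0 Q lam \<nu> \<omega> L" and L: "L \<in> ext_selberg_class"
    and s0: "Re s0 < 0" "L s0 = 0"
  shows "L (1 - cnj s0) = 0"
proof -
  have Q: "Q > 0" and \<omega>: "norm \<omega> = 1" using fe by (auto simp: functional_equation_def)
  define R where "R = (\<lambda>s. \<omega> * cnj (completed_L 0 Q lam \<nu> L (1 - cnj s)))"
  have ne: "s0 \<noteq> 1" "1 - cnj s0 \<noteq> 1" using s0(1) by auto
  have "isCont R s0"
    unfolding R_def
    by (intro functional_equation_isCont Q s0 ext_selberg_class_isCont[OF L] ne) auto
  moreover have "isCont (\<lambda>s. L s * of_real Q powr s) s0"
    using ext_selberg_class_isCont[OF L ne(1)] Q by (intro continuous_intros) auto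
  moreover have "eventually (\<lambda>s. completed_L 0 Q lam \<nu> L s = R s) (at s0)"
    using fe unfolding functional_equation_def R_def
    by (auto intro: eventually_cosparse_imp_eventually_at)
  hence "eventually (\<lambda>s. L s * of_real Q powr s = R s) (at s0)"
    by (simp add: completed_L_def)
  ultimately have "((\<lambda>s. L s * of_real Q powr s) \<longlongrightarrow> R s0) (at s0)"
    "((\<lambda>s. L s * of_real Q powr s) \<longlongrightarrow> L s0 * of_real Q powr s0) (at s0)"
    by (auto simp: isCont_def cong: filterlim_cong)
  hence "R s0 = L s0 * of_real Q powr s0" by (intro tendsto_unique[of "at s0"]) auto
  hence "R s0 = 0" using s0(2) by simp
  moreover have "\<omega> \<noteq> 0" using \<omega> by auto
  ultimately show ?thesis using Q by (simp add: R_def completed_L_def)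
qed

text \<open>A Gamma factor in the second equation produces trivial zeros arbitrarily far to the
  left. The first equation reflects them arbitrarily far to the right, where the leading Dirichlet
  term excludes zeros.\<close>

lemma functional_equation_degree_0_unique:
  assumes L: "L \<in> ext_selberg_class" "\<not> L constant_on UNIV" "dirichlet_expansion a L" "a 1 \<noteq> 0"
    and fe: "functional_equation 0 Q lam \<nu> \<omega> L" and fe': "functional_equation K Q' lam' \<nu>' \<omega>' L"
  shows "K = 0"
proof (rule ccontr)
  assume "K \<noteq> 0"
  hence K: "K \<ge> 1" by simp
  have pos: "lam' 1 > 0" "Re (\<nu>' 1) \<ge> 0" using fe' K by (auto simp: functional_equation_def)
  obtain N c \<delta> B where lead: "N \<ge> (1::nat)" "c \<noteq> 0" "\<delta> > 0" "B > 0"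
    "\<And>s. Re s \<ge> 2 \<Longrightarrow> norm (exp (of_real (ln (real N)) * s) * (L s - 0) - c) \<le> B * exp (- \<delta> * Re s)"
    "a 1 \<noteq> 0 \<Longrightarrow> N = 1 \<and> c = a 1 - 0"
    by (rule leading_term[OF L(1-3), of 0]) (rule that)
  have "((\<lambda>n::nat. B * exp (- \<delta> * (real n / lam' 1))) \<longlongrightarrow> 0) at_top"
    using lead(3) pos(1) by real_asymp
  hence "eventually (\<lambda>n::nat. B * exp (- \<delta> * (real n / lam' 1)) < norm c) at_top"
    using lead(2) by (intro order_tendstoD(2)) auto
  moreover have "eventually (\<lambda>n::nat. real n \<ge> 2 * lam' 1) at_top"
    by real_asymp
  ultimately have "eventually (\<lambda>n::nat. B * exp (- \<delta> * (real n / lam' 1)) < norm c \<and> real n \<ge> 2 * lam' 1 \<and> n \<ge> 1) at_top"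
    by (intro eventually_conj eventually_ge_at_top)
  \<comment> \<open>The reflected zero has real part at least \<open>n / lam' 1\<close>. The
    conditions put it into the range of the leading term estimate, make the error there smaller than
    \<open>norm c\<close>, and meet the requirement of \<open>trivial_zero\<close>.\<close>
  then obtain n :: nat where n: "B * exp (- \<delta> * (real n / lam' 1)) < norm c" "real n \<ge> 2 * lam' 1" "n \<ge> 1"
    by (auto dest: eventually_happens)
  define s0 where "s0 = - (of_nat n + \<nu>' 1) / of_real (lam' 1)"
  have "L s0 = 0" "Re s0 < 0"
    unfolding s0_def using trivial_zero[OF fe' K n(3)] ext_selberg_class_isCont[OF L(1)] by auto
  hence zero: "L (1 - cnj s0) = 0" using reflected_zero_degree_0[OF fe L(1)] by blast
  have "Re (1 - cnj s0) = 1 + (real n + Re (\<nu>' 1)) / lam' 1"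
    by (simp add: s0_def Re_divide_of_real minus_divide_left)
  moreover have "(real n + Re (\<nu>' 1)) / lam' 1 \<ge> real n / lam' 1"
    using pos by (intro divide_right_mono) auto
  ultimately have Re: "Re (1 - cnj s0) \<ge> real n / lam' 1" by linarith
  moreover have "real n / lam' 1 \<ge> 2" using n(2) pos(1) by (simp add: field_simps)
  ultimately have "norm c \<le> B * exp (- \<delta> * Re (1 - cnj s0))"
    using lead(5)[of "1 - cnj s0"] zero by simp
  also have "\<dots> \<le> B * exp (- \<delta> * (real n / lam' 1))"
  proof -
    have "\<delta> * (real n / lam' 1) \<le> \<delta> * Re (1 - cnj s0)"
      using Re lead(3) by (intro mult_left_mono) auto
    hence "- \<delta> * Re (1 - cnj s0) \<le> - \<delta> * (real n / lam' 1)" by linarith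
    thus ?thesis using lead(4) by (intro mult_left_mono) (auto simp del: One_nat_def)
  qed
  finally show False using n(1) by linarith
qed

text \<open>The choice in \<open>selberg_degree\<close> selects some functional equation of
  \<open>L\<close>, which need not be the one under consideration elsewhere; a nonzero degree only
  yields that one equation with a Gamma factor exists.\<close>

lemma selberg_degree_nonzero:
  assumes "L \<in> ext_selberg_class" "selberg_degree L \<noteq> 0"
  obtains K Q lam \<nu> \<omega> where "functional_equation K Q lam \<nu> \<omega> L" "K \<noteq> 0"
proof -
  have "\<exists>d K Q lam \<nu> \<omega>. functional_equation K Q lam \<nu> \<omega> L \<and> d = 2 * (\<Sum>j=1..K. lam j)"
    using assms(1) unfolding ext_selberg_class_def by blast
  hence "\<exists>K Q lam \<nu> \<omega>. functional_equation K Q lam \<nu> \<omega> L \<and> selberg_degree L = 2 * (\<Sum>j=1..K. lam j)"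
    unfolding selberg_degree_def by (rule someI_ex)
  then obtain K Q lam \<nu> \<omega> where "functional_equation K Q lam \<nu> \<omega> L" "selberg_degree L = 2 * (\<Sum>j=1..K. lam j)"
    by blast
  moreover from this(2) assms(2) have "K \<noteq> 0" by (intro notI) simp
  ultimately show ?thesis using that by blast
qed

theorem theorem1p3:
  fixes L1 L2 :: "complex \<Rightarrow> complex" and a1 a2 :: "nat \<Rightarrow> complex"
    and \<alpha> :: complex and G :: "complex set"
  assumes "L1 \<in> ext_selberg_class" and "L2 \<in> ext_selberg_class"
    and "\<not> L1 constant_on UNIV" and "\<not> L2 constant_on UNIV"
    and "same_functional_equation L1 L2"
    and "dirichlet_expansion a1 L1" and "a1 1 = 1"
    and "dirichlet_expansion a2 L2" and "a2 1 = 1"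
    and "share_CM_except L1 L2 \<alpha> G"
    and "order_one_convergence_type L1 L2 \<alpha> G"
  shows "(selberg_degree L1 \<noteq> 0 \<and> selberg_degree L2 \<noteq> 0 \<longrightarrow> L1 = L2) \<and>
         (selberg_degree L1 = 0 \<and> selberg_degree L2 = 0 \<and> \<alpha> \<noteq> 1 \<longrightarrow> L1 = L2)"
proof -
  obtain q b where rel: "q \<noteq> 0" "\<And>s. s \<noteq> 1 \<Longrightarrow> L1 s - \<alpha> = q * exp (of_real b * s) * (L2 s - \<alpha>)"
    "a1 1 \<noteq> \<alpha> \<Longrightarrow> a2 1 \<noteq> \<alpha> \<Longrightarrow> b = 0 \<and> q = (a1 1 - \<alpha>) / (a2 1 - \<alpha>)"
    by (rule shared_value_relation[OF assms(1-4,6,8,10,11)]) (rule that)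
  have eqI: "L1 = L2" if "b = 0" "q = 1"
  proof (rule nicely_meromorphic_eq[where ?s0.0 = 1])
    show "L1 nicely_meromorphic_on UNIV" "L2 nicely_meromorphic_on UNIV"
      using assms(1,2) by (auto simp: ext_selberg_class_def)
    show "L1 s = L2 s" if "s \<noteq> 1" for s using rel(2)[OF that] \<open>b = 0\<close> \<open>q = 1\<close> by simp
  qed
  have 1: "L1 = L2" if "\<alpha> \<noteq> 1"
    using rel(3) that assms(7,9) by (intro eqI) auto
  have 2: "L1 = L2" if deg: "selberg_degree L1 \<noteq> 0" and "\<alpha> = 1"
  proof -
    obtain K' Q' lam' \<nu>' \<omega>' where fe': "functional_equation K' Q' lam' \<nu>' \<omega>' L1" "K' \<noteq> 0"
      by (rule selberg_degree_nonzero[OF assms(1) deg]) (rule that)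
    obtain K Q lam \<nu> \<omega> where fe: "functional_equation K Q lam \<nu> \<omega> L1" "functional_equation K Q lam \<nu> \<omega> L2"
      using assms(5) unfolding same_functional_equation_def by blast
    \<comment> \<open>Passes from the equation behind the degree to the shared one: if the latter
      had no Gamma factor, no equation of \<open>L1\<close> would have any.\<close>
    have "K \<noteq> 0"
    proof
      assume "K = 0"
      hence "functional_equation 0 Q lam \<nu> \<omega> L1" using fe(1) by simp
      hence "K' = 0"
        using functional_equation_degree_0_unique[OF assms(1,3,6) _ _ fe'(1)] assms(7) by simp
      thus False using fe'(2) by simp
    qed
    hence K: "K \<ge> 1" by simp
    have pos: "lam 1 > 0" using fe(1) K by (auto simp: functional_equation_def)
    \<comment> \<open>The trivial zeros of both functions coincide because \<open>lam 1\<close> and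
      \<open>\<nu> 1\<close> are shared; at such a point the relation reads
      \<open>- 1 = - q * exp (b * s)\<close>.\<close>
    have at_zero: "q * exp (of_real b * (- (of_nat n + \<nu> 1) / of_real (lam 1))) = 1" if n: "n \<ge> 1" for n :: nat
    proof -
      define s where "s = - (of_nat n + \<nu> 1) / of_real (lam 1)"
      have z1: "L1 s = 0" "Re s < 0"
        unfolding s_def using trivial_zero[OF fe(1) K n] ext_selberg_class_isCont[OF assms(1)] by auto
      have z2: "L2 s = 0"
        unfolding s_def using trivial_zero(1)[OF fe(2) K n] ext_selberg_class_isCont[OF assms(2)] by auto
      have "s \<noteq> 1" using z1(2) by auto
      from rel(2)[OF this] show ?thesis using z1 z2 \<open>\<alpha> = 1\<close> by (simp add: s_def)
    qed
    define e where "e = (\<lambda>n::nat. of_real b * (- (of_nat n + \<nu> 1) / of_real (lam 1)) :: complex)"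
    \<comment> \<open>Consecutive trivial zeros differ by the real step \<open>1 / lam 1\<close>. As
      \<open>b\<close> is real, comparing moduli gives \<open>b = 0\<close> without ambiguity from
      the period of \<open>exp\<close>.\<close>
    have "q * exp (e 1) = q * exp (e 2)" using at_zero[of 1] at_zero[of 2] by (simp add: e_def)
    hence "exp (e 1) = exp (e 2)" using rel(1) by simp
    hence "norm (exp (e 1)) = norm (exp (e 2))" by simp
    hence "Re (e 1) = Re (e 2)" by simp
    hence "b / lam 1 = 0" using pos by (simp add: e_def Re_divide_of_real field_simps)
    hence b: "b = 0" using pos by simp
    moreover have "q = 1" using at_zero[of 1] b by simp
    ultimately show ?thesis by (rule eqI)
  qed
  show ?thesis using 1 2 by blast
qed

end
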